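(* For every integer $s\ge 3$ there exists a real number $\varepsilon_s>0$ (depending only on $s$) such that for all positive integers $k$, $$f(sk+1,k,s)\le \Bigl(\frac{s-1}{s}-\varepsilon_s\Bigr)\binom{sk+1}{k}.$$
   Context: Let $[n]=\{1,\dots,n\}$ and let $\binom{[n]}{k}$ denote the family of all $k$-element subsets of $[n]$. The matching number $\nu(\mathcal{F})$ of a family $\mathcal{F}$ of sets is the maximum number of pairwise disjoint members of $\mathcal{F}$. For positive integers $n,k,s$, $f(n,k,s)$ denotes the maximum size of a family $\mathcal{F}\subseteq\binom{[n]}{k}$ with $\nu(\mathcal{F})<s$ (i.e. containing no $s$ pairwise disjoint sets). *)

theory Defs
  imports Complex_Main
begin

definition k_subsets :: "nat \<Rightarrow> nat \<Rightarrow> nat set set" where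
  "k_subsets n k = {A. A \<subseteq> {1..n} \<and> card A = k}"

(* Intended for finite families, since Max is unspecified on infinite sets. *)
definition matching_number :: "'a set set \<Rightarrow> nat" where
  "matching_number F = Max {card M | M. M \<subseteq> F \<and> pairwise disjnt M}"

(* For s = 0 no family is admissible and the value is unspecified; for s > 0
   the empty family is admissible, so the maximum exists. *)
definition max_family_size :: "nat \<Rightarrow> nat \<Rightarrow> nat \<Rightarrow> nat" where
  "max_family_size n k s = Max {card F | F. F \<subseteq> k_subsets n k \<and> matching_number F < s}"

lemma finite_k_subsets: "finite (k_subsets n k)"
  unfolding k_subsets_def by (rule finite_subset [of _ "Pow {1..n}"]) auto

lemma matching_number_well_defined:
  assumes "finite F"
  shows "finite {card M | M. M \<subseteq> F \<and> pairwise disjnt M}"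
    and "{card M | M. M \<subseteq> F \<and> pairwise disjnt M} \<noteq> {}"
proof -
  have "{card M | M. M \<subseteq> F \<and> pairwise disjnt M} \<subseteq> card ` Pow F" by auto
  then show "finite {card M | M. M \<subseteq> F \<and> pairwise disjnt M}"
    by (rule finite_subset) (simp add: assms)
  show "{card M | M. M \<subseteq> F \<and> pairwise disjnt M} \<noteq> {}"
  proof -
    have "card {} \<in> {card M | M. M \<subseteq> F \<and> pairwise disjnt M}"
      unfolding mem_Collect_eq by (rule exI [of _ "{}"]) (simp add: pairwise_empty)
    then show ?thesis by (metis empty_iff)
  qed
qed

lemma matching_number_empty: "matching_number {} = 0"
proof -
  have "{card M | M. M \<subseteq> {} \<and> pairwise disjnt M} = {0}" by (auto simp: pairwise_empty)
  then show ?thesis by (simp add: matching_number_def)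
qed

lemma max_family_size_well_defined:
  shows "finite {card F | F. F \<subseteq> k_subsets n k \<and> matching_number F < s}"
    and "s > 0 \<Longrightarrow> {card F | F. F \<subseteq> k_subsets n k \<and> matching_number F < s} \<noteq> {}"
proof -
  have "{card F | F. F \<subseteq> k_subsets n k \<and> matching_number F < s} \<subseteq> card ` Pow (k_subsets n k)"
    by auto
  then show "finite {card F | F. F \<subseteq> k_subsets n k \<and> matching_number F < s}"
    by (rule finite_subset) (simp add: finite_k_subsets)
  show "{card F | F. F \<subseteq> k_subsets n k \<and> matching_number F < s} \<noteq> {}" if "s > 0"
  proof -
    have "card {} \<in> {card F | F. F \<subseteq> k_subsets n k \<and> matching_number F < s}"
      unfolding mem_Collect_eq
      by (rule exI [of _ "{}"]) (simp add: matching_number_empty that)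
    then show ?thesis by (metis empty_iff)
  qed
qed

end

theory Submission
  imports Defs "HOL-Combinatorics.Permutations" "HOL-Library.FuncSet" "HOL-Library.Disjoint_Sets"
begin

text \<open>
  Let \<open>E\<close> have \<open>s * k + 1\<close> elements, and let \<open>G\<close> be the set of \<open>k\<close>-subsets of \<open>E\<close> that are missing
  from a family without \<open>s\<close> pairwise disjoint members. Then \<open>G\<close> meets every \<open>s\<close> disjoint
  \<open>k\<close>-sets. Applying a random permutation to \<open>s\<close> fixed disjoint sets shows that the density of \<open>G\<close>
  is \<open>(1 + excess) / s\<close> with \<open>excess \<ge> 0\<close>, and the claim is a lower bound for \<open>excess\<close> that does
  not depend on \<open>k\<close>.

  The average gives more than the sign: \<open>s\<close> random disjoint sets contain exactly one member of \<open>G\<close>,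
  up to probability \<open>excess\<close> (\<open>hits_once\<close>). One of the sets can be changed by exchanging an element with
  the element that is left over, so membership in \<open>G\<close> rarely changes under a single exchange; walking
  from one block to another, which cannot both be the unique member, yields
  \<open>excess \<ge> 1 / (1 + 2 s k)\<close> (\<open>excess_lower_bound\<close>). This settles every bounded range of \<open>k\<close>.

  For large \<open>k\<close> and tiny \<open>excess\<close>, membership in \<open>G\<close> would have to be governed by one element, as it is
  for the family of all sets through a point. The mechanism is an exchange argument: if two disjoint
  sets \<open>X \<union> Y\<close> and \<open>X' \<union> Y'\<close> are recombined to \<open>X \<union> Y'\<close> and \<open>X' \<union> Y\<close>, the number of members of \<open>G\<close> stays
  the same and is at most one. Hence membership cannot depend on both parts, and it depends on
  \<open>X\<close> in the same way for all \<open>Y\<close>. A first consequence is that replacing a small part of a \<open>k\<close>-set rarely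
  matters (\<open>hits_stable\<close>), since among many small parts only one can matter.

  Parts of a random \<open>k\<close>-set are not independent, but by this stability a \<open>k\<close>-set may be replaced by
  a colour class of a uniformly random colouring of \<open>E\<close> with \<open>s\<close> colours, whose size is \<open>k\<close> up to
  about \<open>sqrt k\<close>. There the exchange argument, together with independence, shows that for every cut
  of \<open>E\<close> acceptance is insensitive to one of the two sides (\<open>sensitivity_product\<close>). A
  maximal proper set of irrelevant coordinates then leaves one relevant coordinate \<open>e\<close> (\<open>dictator\<close>).

  Transferred back, \<open>G\<close> contains almost all or almost none of the \<open>k\<close>-sets that avoid \<open>e\<close>
  (\<open>near_dictator\<close>). Almost none is impossible, because \<open>E - {e}\<close> has \<open>s * k\<close> elements and \<open>G\<close> meets each of
  its partitions into \<open>s\<close> blocks of size \<open>k\<close>; almost all is impossible, because those sets have density at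
  least \<open>1 - 1/s\<close>, which exceeds \<open>1/s\<close>.

  The hypothesis \<open>s \<ge> 3\<close> provides a third block or colour: two arbitrary sets can be linked through one
  that is disjoint from both. For \<open>s = 2\<close> the statement fails, as intersecting families such
  as the \<open>k\<close>-subsets of \<open>{1..2 * k + 1}\<close> through a point have density tending to \<open>1/2\<close>.
\<close>

section \<open>Averages over finite sets\<close>

definition avg :: "'a set \<Rightarrow> ('a \<Rightarrow> real) \<Rightarrow> real" where
  "avg S f = (\<Sum>x\<in>S. f x) / real (card S)"

definition freq :: "'a set \<Rightarrow> ('a \<Rightarrow> bool) \<Rightarrow> real" where
  "freq S P = avg S (\<lambda>x. of_bool (P x))"

lemma avg_mono: "(\<And>x. x \<in> S \<Longrightarrow> f x \<le> g x) \<Longrightarrow> avg S f \<le> avg S g"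
  unfolding avg_def by (intro divide_right_mono sum_mono) auto

lemma avg_cong: "(\<And>x. x \<in> S \<Longrightarrow> f x = g x) \<Longrightarrow> avg S f = avg S g"
  unfolding avg_def by (simp cong: sum.cong)

lemma avg_add: "avg S (\<lambda>x. f x + g x) = avg S f + avg S g"
  unfolding avg_def by (simp add: sum.distrib add_divide_distrib)

lemma avg_cmult: "avg S (\<lambda>x. c * f x) = c * avg S f"
  unfolding avg_def by (simp add: sum_distrib_left)

lemma avg_sum: "avg S (\<lambda>x. \<Sum>i\<in>I. f i x) = (\<Sum>i\<in>I. avg S (f i))"
  unfolding avg_def by (simp add: sum.swap [of _ S] sum_divide_distrib)

lemma avg_const: "finite S \<Longrightarrow> S \<noteq> {} \<Longrightarrow> avg S (\<lambda>x. c) = c"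
  unfolding avg_def by (simp add: card_gt_0_iff)

lemma avg_bound: "finite S \<Longrightarrow> S \<noteq> {} \<Longrightarrow> (\<And>x. x \<in> S \<Longrightarrow> f x \<le> c) \<Longrightarrow> avg S f \<le> c"
  using avg_mono [of S f "\<lambda>_. c"] avg_const [of S c] by simp

lemma avg_swap: "avg S (\<lambda>x. avg T (f x)) = avg T (\<lambda>y. avg S (\<lambda>x. f x y))"
  unfolding avg_def
  by (simp add: sum_divide_distrib [symmetric] sum.swap [of _ S] mult.commute)

lemma avg_Times: "avg (S \<times> T) f = avg S (\<lambda>x. avg T (\<lambda>y. f (x, y)))"
  unfolding avg_def
  by (simp add: sum.cartesian_product card_cartesian_product sum_divide_distrib [symmetric] mult.commute)

lemma avg_reindex: "bij_betw h S T \<Longrightarrow> avg T f = avg S (\<lambda>x. f (h x))"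
  unfolding avg_def by (simp add: sum.reindex_bij_betw bij_betw_same_card)

lemma avg_exists_le:
  assumes "finite S" "S \<noteq> {}"
  shows "\<exists>x\<in>S. f x \<le> avg S f"
proof (rule ccontr)
  assume "\<not> ?thesis"
  then have "(\<Sum>x\<in>S. avg S f) < (\<Sum>x\<in>S. f x)"
    using assms by (intro sum_strict_mono) auto
  then show False
    using assms by (simp add: avg_def)
qed

lemma freq_mono: "(\<And>x. x \<in> S \<Longrightarrow> P x \<Longrightarrow> Q x) \<Longrightarrow> freq S P \<le> freq S Q"
  unfolding freq_def by (rule avg_mono) auto

lemma freq_disj: "freq S (\<lambda>x. P x \<or> Q x) \<le> freq S P + freq S Q"
  unfolding freq_def avg_add [symmetric] by (rule avg_mono) auto

lemma freq_le2:
  assumes "\<And>x. x \<in> S \<Longrightarrow> R x \<Longrightarrow> P x \<or> Q x"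
  shows "freq S R \<le> freq S P + freq S Q"
  using freq_mono [of S R "\<lambda>x. P x \<or> Q x"] freq_disj [of S P Q] assms by fastforce

lemma freq_le3:
  assumes "\<And>x. x \<in> S \<Longrightarrow> R x \<Longrightarrow> P x \<or> Q x \<or> P' x"
  shows "freq S R \<le> freq S P + freq S Q + freq S P'"
  using freq_le2 [of S R P "\<lambda>x. Q x \<or> P' x"] freq_disj [of S Q P'] assms by fastforce

lemma freq_Bex:
  assumes "finite I" "\<And>x. x \<in> S \<Longrightarrow> R x \<Longrightarrow> \<exists>i\<in>I. P i x"
  shows "freq S R \<le> (\<Sum>i\<in>I. freq S (P i))"
proof -
  have "of_bool (R x) \<le> (\<Sum>i\<in>I. of_bool (P i x) :: real)" if "x \<in> S" for x
  proof (cases "R x")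
    case True
    then obtain i where i: "i \<in> I" "P i x" using assms(2) \<open>x \<in> S\<close> by blast
    show ?thesis using member_le_sum [of i I "\<lambda>i. of_bool (P i x) :: real"] i assms by auto
  qed (simp add: sum_nonneg)
  then show ?thesis unfolding freq_def avg_sum [symmetric] by (rule avg_mono)
qed

lemma freq_nonneg: "0 \<le> freq S P"
  unfolding freq_def avg_def by (simp add: sum_nonneg)

lemma freq_le_1: "freq S P \<le> 1"
proof (cases "finite S \<and> S \<noteq> {}")
  case True
  then show ?thesis unfolding freq_def by (intro avg_bound) auto
next
  case False
  then show ?thesis by (auto simp: freq_def avg_def)
qed

lemma freq_True: "finite S \<Longrightarrow> S \<noteq> {} \<Longrightarrow> (\<And>x. x \<in> S \<Longrightarrow> P x) \<Longrightarrow> freq S P = 1"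
  unfolding freq_def using avg_cong [of S "\<lambda>x. of_bool (P x)" "\<lambda>_. 1"] avg_const [of S 1] by simp

lemma freq_card: "freq S P = real (card {x \<in> S. P x}) / real (card S)"
proof (cases "finite S")
  case True
  then show ?thesis unfolding freq_def avg_def by (simp add: sum.If_cases of_bool_def Int_def)
qed (simp add: freq_def avg_def)

section \<open>Random permutations and k-sets\<close>

definition Perm :: "nat set \<Rightarrow> (nat \<Rightarrow> nat) set" where
  "Perm E = {p. p permutes E}"

lemma finite_Perm: "finite E \<Longrightarrow> finite (Perm E)"
  unfolding Perm_def by (rule finite_permutations)

lemma Perm_nonempty: "Perm E \<noteq> {}"
  unfolding Perm_def using permutes_id by blast

lemma avg_Perm_right:
  assumes "\<tau> \<in> Perm E"
  shows "avg (Perm E) (\<lambda>\<sigma>. f (\<sigma> \<circ> \<tau>)) = avg (Perm E) f"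
proof -
  have "bij_betw (\<lambda>\<sigma>. \<sigma> \<circ> \<tau>) (Perm E) (Perm E)"
  proof (rule bij_betwI [where g = "\<lambda>\<sigma>. \<sigma> \<circ> inv \<tau>"])
    show "(\<lambda>\<sigma>. \<sigma> \<circ> \<tau>) \<in> Perm E \<rightarrow> Perm E" "(\<lambda>\<sigma>. \<sigma> \<circ> inv \<tau>) \<in> Perm E \<rightarrow> Perm E"
      using assms by (auto simp: Perm_def permutes_compose permutes_inv)
  qed (use assms in \<open>auto simp: Perm_def o_assoc [symmetric] permutes_inv_o\<close>)
  from avg_reindex [OF this, of f] show ?thesis by simp
qed

text \<open>
  All invariance arguments for random permutations rest on this: two labellings with equally large
  classes differ by a permutation, and composing with it leaves the uniform measure unchanged.
\<close>

lemma exists_perm_same_labels: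
  assumes fin: "finite E"
    and eq: "\<And>c. card {x \<in> E. a x = c} = card {x \<in> E. b x = c}"
  obtains \<tau> where "\<tau> \<in> Perm E" "\<And>x. x \<in> E \<Longrightarrow> b (\<tau> x) = a x"
proof -
  have "image_mset a (mset_set E) = image_mset b (mset_set E)"
  proof (rule multiset_eqI)
    fix c
    have "count (image_mset f (mset_set E)) c = card {x \<in> E. f x = c}" for f :: "nat \<Rightarrow> 'a"
      using fin by (simp add: count_image_mset vimage_def Int_def conj_commute)
    then show "count (image_mset a (mset_set E)) c = count (image_mset b (mset_set E)) c"
      using eq by simp
  qed
  from image_mset_eq_implies_permutes [OF fin this] that show thesis
    unfolding Perm_def by (metis mem_Collect_eq)
qed

definition ksets :: "nat set \<Rightarrow> nat \<Rightarrow> nat set set" where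
  "ksets E k = {A. A \<subseteq> E \<and> card A = k}"

lemma finite_ksets: "finite E \<Longrightarrow> finite (ksets E k)"
  unfolding ksets_def by simp

lemma ksets_nonempty: "k \<le> card E \<Longrightarrow> ksets E k \<noteq> {}"
  unfolding ksets_def using obtain_subset_with_card_n [of k E] by auto

lemma Perm_inj: "\<tau> \<in> Perm E \<Longrightarrow> inj \<tau>"
  unfolding Perm_def by (simp add: permutes_inj)

lemma Perm_image: "\<tau> \<in> Perm E \<Longrightarrow> A \<subseteq> E \<Longrightarrow> \<tau> ` A \<subseteq> E"
  unfolding Perm_def by (auto simp: permutes_in_image)

lemma card_Perm_image: "\<tau> \<in> Perm E \<Longrightarrow> card (\<tau> ` A) = card A"
  by (meson Perm_inj card_image inj_on_subset subset_UNIV)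

lemma ksets_image: "\<tau> \<in> Perm E \<Longrightarrow> A \<in> ksets E k \<Longrightarrow> \<tau> ` A \<in> ksets E k"
  unfolding ksets_def by (simp add: Perm_image card_Perm_image)

lemma bij_betw_ksets_image:
  assumes "\<tau> \<in> Perm E"
  shows "bij_betw ((`) \<tau>) (ksets E k) (ksets E k)"
proof (rule bij_betwI [where g = "(`) (inv \<tau>)"])
  have "inv \<tau> \<in> Perm E" using assms by (simp add: Perm_def permutes_inv)
  then show "(`) \<tau> \<in> ksets E k \<rightarrow> ksets E k" "(`) (inv \<tau>) \<in> ksets E k \<rightarrow> ksets E k"
    using assms ksets_image by auto
qed (use assms in \<open>auto simp: Perm_def image_comp permutes_inv_o\<close>)

lemma exists_perm_pair:
  assumes fin: "finite E"
    and A: "A \<in> ksets E k" "A' \<in> ksets E k" and B: "B \<in> ksets E k" "B' \<in> ksets E k"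
    and d: "card (A - A') = card (B - B')"
  obtains \<tau> where "\<tau> \<in> Perm E" "\<tau> ` A = B" "\<tau> ` A' = B'"
proof -
  have fA: "finite A" "finite A'" "finite B" "finite B'"
    and sub: "A \<subseteq> E" "A' \<subseteq> E" "B \<subseteq> E" "B' \<subseteq> E"
    and card: "card A = k" "card A' = k" "card B = k" "card B' = k"
    using A B fin by (auto simp: ksets_def finite_subset)
  have int: "card (A \<inter> A') = card (B \<inter> B')"
    using card_Diff_subset_Int [of A A'] card_Diff_subset_Int [of B B'] d card fA
      card_mono [of A "A \<inter> A'"] card_mono [of B "B \<inter> B'"] by simp
  have d': "card (A' - A) = card (B' - B)"
    using card_Diff_subset_Int [of A' A] card_Diff_subset_Int [of B' B] int card fA
    by (simp add: Int_commute)
  have un: "card (E - (A \<union> A')) = card (E - (B \<union> B'))"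
    using card_Un_Int [of A A'] card_Un_Int [of B B'] int card fA sub fin
    by (simp add: card_Diff_subset)
  have fib: "card {x \<in> E. (x \<in> A, x \<in> A') = c} = card {x \<in> E. (x \<in> B, x \<in> B') = c}" for c
  proof -
    have *: "{x \<in> E. (x \<in> X, x \<in> X') = (u, v)} =
       (if u then if v then X \<inter> X' else X - X' else if v then X' - X else E - (X \<union> X'))"
      if "X \<subseteq> E" "X' \<subseteq> E" for X X' u v
      using that by auto
    obtain u v where c: "c = (u, v)" by (cases c)
    show ?thesis unfolding c * [OF sub(1,2)] * [OF sub(3,4)] using d d' int un by simp
  qed
  obtain \<tau> where \<tau>: "\<tau> \<in> Perm E" "\<And>x. x \<in> E \<Longrightarrow> (\<tau> x \<in> B, \<tau> x \<in> B') = (x \<in> A, x \<in> A')"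
    using exists_perm_same_labels [OF fin fib] by blast
  have "\<tau> ` A = B" using \<tau> sub card fA card_Perm_image [OF \<tau>(1)]
    by (intro card_subset_eq) auto
  moreover have "\<tau> ` A' = B'" using \<tau> sub card fA card_Perm_image [OF \<tau>(1)]
    by (intro card_subset_eq) auto
  ultimately show thesis using that \<tau>(1) by blast
qed

lemma avg_perm_pair:
  assumes fin: "finite E"
    and A: "A \<in> ksets E k" "A' \<in> ksets E k" and B: "B \<in> ksets E k" "B' \<in> ksets E k"
    and d: "card (A - A') = card (B - B')"
  shows "avg (Perm E) (\<lambda>\<sigma>. h (\<sigma> ` A) (\<sigma> ` A')) = avg (Perm E) (\<lambda>\<sigma>. h (\<sigma> ` B) (\<sigma> ` B'))"
proof -
  obtain \<tau> where \<tau>: "\<tau> \<in> Perm E" "\<tau> ` A = B" "\<tau> ` A' = B'"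
    by (rule exists_perm_pair [OF assms])
  show ?thesis
    using avg_Perm_right [OF \<tau>(1), of "\<lambda>\<sigma>. h (\<sigma> ` A) (\<sigma> ` A')"]
    by (simp only: image_comp [symmetric] \<tau>(2,3))
qed

lemma avg_perm_image:
  assumes fin: "finite E" and A: "A \<in> ksets E k"
  shows "avg (Perm E) (\<lambda>\<sigma>. h (\<sigma> ` A)) = avg (ksets E k) h"
proof -
  have "avg (Perm E) (\<lambda>\<sigma>. h (\<sigma> ` A)) = avg (ksets E k) (\<lambda>B. avg (Perm E) (\<lambda>\<sigma>. h (\<sigma> ` A)))"
    by (rule avg_const [symmetric]) (use finite_ksets [OF fin] A in auto)
  also have "\<dots> = avg (ksets E k) (\<lambda>B. avg (Perm E) (\<lambda>\<sigma>. h (\<sigma> ` B)))"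
  proof (rule avg_cong)
    fix B assume B: "B \<in> ksets E k"
    show "avg (Perm E) (\<lambda>\<sigma>. h (\<sigma> ` A)) = avg (Perm E) (\<lambda>\<sigma>. h (\<sigma> ` B))"
      by (rule avg_perm_pair [OF fin A A B B, of "\<lambda>X Y. h X"]) (simp only: Diff_cancel)
  qed
  also have "\<dots> = avg (Perm E) (\<lambda>\<sigma>. avg (ksets E k) (\<lambda>B. h (\<sigma> ` B)))"
    by (rule avg_swap)
  also have "\<dots> = avg (Perm E) (\<lambda>\<sigma>. avg (ksets E k) h)"
    by (intro avg_cong avg_reindex [symmetric] bij_betw_ksets_image)
  also have "\<dots> = avg (ksets E k) h"
    by (rule avg_const [OF finite_Perm [OF fin] Perm_nonempty])
  finally show ?thesis .
qed

lemma obtain_disjoint_ksets: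
  assumes "finite W" "r * k \<le> card W"
  obtains Q where "\<And>i. i < r \<Longrightarrow> Q i \<in> ksets W k" "disjoint_family_on Q {..<r}"
proof -
  have "\<exists>Q. (\<forall>i<r. Q i \<in> ksets W k) \<and> disjoint_family_on Q {..<r}"
    using assms
  proof (induction r arbitrary: W)
    case (Suc r)
    obtain X where X: "X \<subseteq> W" "card X = k"
      using obtain_subset_with_card_n [of k W] Suc.prems by auto
    have "card (W - X) = card W - k" using X Suc.prems by (simp add: card_Diff_subset finite_subset)
    then have "r * k \<le> card (W - X)" using Suc.prems by simp
    with Suc.IH [of "W - X"] Suc.prems
    obtain Q where Q: "\<forall>i<r. Q i \<in> ksets (W - X) k" "disjoint_family_on Q {..<r}"
      by auto
    have mem: "Q i \<in> ksets W k \<and> Q i \<inter> X = {}" if "i < r" for i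
      using Q(1) that by (auto simp: ksets_def)
    have "\<forall>i<Suc r. (Q(r := X)) i \<in> ksets W k"
      using mem X by (auto simp: ksets_def less_Suc_eq)
    moreover have "disjoint_family_on (Q(r := X)) {..<Suc r}"
      unfolding disjoint_family_on_def
    proof (intro ballI impI)
      fix i j assume "i \<in> {..<Suc r}" "j \<in> {..<Suc r}" "i \<noteq> j"
      then show "(Q(r := X)) i \<inter> (Q(r := X)) j = {}"
        using mem [of i] mem [of j] Q(2)
        by (cases "i = r"; cases "j = r") (auto simp: disjoint_family_on_def)
    qed
    ultimately have "(\<forall>i<Suc r. (Q(r := X)) i \<in> ksets W k) \<and> disjoint_family_on (Q(r := X)) {..<Suc r}"
      by blast
    then show ?case by blast
  qed (simp add: disjoint_family_on_def)
  then show thesis using that by blast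
qed

text \<open>
  The number of sets \<open>\<sigma> ` P i\<close> in \<open>G\<close> is at least one for every \<open>\<sigma>\<close>, and its average is \<open>s\<close> times the
  density of \<open>G\<close>. So the probability that it differs from one is at most the amount by which the
  average exceeds one.
\<close>

lemma hitting_density:
  assumes fin: "finite E" and P: "\<And>i. i < s \<Longrightarrow> P i \<in> ksets E k"
    and hit: "\<And>\<sigma>. \<sigma> \<in> Perm E \<Longrightarrow> \<exists>i<s. \<sigma> ` P i \<in> G"
  shows "freq (Perm E) (\<lambda>\<sigma>. (\<Sum>i<s. of_bool (\<sigma> ` P i \<in> G)) \<noteq> (1::nat))
           \<le> real s * freq (ksets E k) (\<lambda>A. A \<in> G) - 1"
proof -
  have "freq (Perm E) (\<lambda>\<sigma>. (\<Sum>i<s. of_bool (\<sigma> ` P i \<in> G)) \<noteq> (1::nat)) + 1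
     = avg (Perm E) (\<lambda>\<sigma>. of_bool ((\<Sum>i<s. of_bool (\<sigma> ` P i \<in> G)) \<noteq> (1::nat)) + 1)"
    unfolding avg_add freq_def using avg_const [OF finite_Perm [OF fin] Perm_nonempty] by simp
  also have "\<dots> \<le> avg (Perm E) (\<lambda>\<sigma>. \<Sum>i<s. of_bool (\<sigma> ` P i \<in> G))"
  proof (rule avg_mono)
    fix \<sigma> assume "\<sigma> \<in> Perm E"
    then obtain i where "i < s" "\<sigma> ` P i \<in> G" using hit by blast
    then have "(\<Sum>i<s. of_bool (\<sigma> ` P i \<in> G)) \<ge> (1::nat)"
      using member_le_sum [of i "{..<s}" "\<lambda>i. of_bool (\<sigma> ` P i \<in> G) :: nat"] by simp
    then have "of_bool ((\<Sum>i<s. of_bool (\<sigma> ` P i \<in> G)) \<noteq> (1::nat)) + 1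
        \<le> (\<Sum>i<s. of_bool (\<sigma> ` P i \<in> G) :: nat)" by (auto simp: of_bool_def split: if_splits)
    then have "real (of_bool ((\<Sum>i<s. of_bool (\<sigma> ` P i \<in> G)) \<noteq> (1::nat)) + 1)
        \<le> real (\<Sum>i<s. of_bool (\<sigma> ` P i \<in> G))" by (rule of_nat_mono)
    then show "of_bool ((\<Sum>i<s. of_bool (\<sigma> ` P i \<in> G)) \<noteq> (1::nat)) + 1
        \<le> (\<Sum>i<s. of_bool (\<sigma> ` P i \<in> G) :: real)" by (simp only: of_nat_add of_nat_1 of_nat_of_bool of_nat_sum)
  qed
  also have "\<dots> = real s * freq (ksets E k) (\<lambda>A. A \<in> G)"
    unfolding avg_sum using avg_perm_image [OF fin P, of _ "\<lambda>A. of_bool (A \<in> G)"]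
    by (simp add: freq_def)
  finally show ?thesis by simp
qed

section \<open>Families that meet every packing\<close>

text \<open>
  The arguments stand for the acceptance of \<open>X \<union> Y\<close>, \<open>X \<union> Y'\<close>, \<open>X' \<union> Y\<close> and \<open>X' \<union> Y'\<close>, for sets \<open>X\<close>, \<open>X'\<close>,
  \<open>Y\<close>, \<open>Y'\<close> or likewise for mixtures of words. Both pairs of opposite arguments, which are disjoint, contain
  equally many accepted objects, and at most one.
\<close>

definition balanced :: "bool \<Rightarrow> bool \<Rightarrow> bool \<Rightarrow> bool \<Rightarrow> bool" where
  "balanced a b c d \<longleftrightarrow> (a \<or> d \<longleftrightarrow> b \<or> c) \<and> \<not> (a \<and> d) \<and> \<not> (b \<and> c)"

lemma balanced_exchange:
  fixes r :: nat
  assumes "of_bool a + of_bool d + r = 1" "of_bool b + of_bool c + r = 1"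
  shows "balanced a b c d"
  using assms unfolding balanced_def by (auto simp: of_bool_def split: if_splits)

text \<open>
  If replacing \<open>X\<close> by \<open>X'\<close> matters next to \<open>Y\<close>, it also matters next to \<open>Y'\<close>, and then neither
  exchange of the second part, from \<open>Y\<close> to \<open>Y'\<close> or from \<open>Y'\<close> to \<open>Y''\<close>, has an effect.
\<close>

lemma balanced_chain:
  assumes "balanced a b c d" "balanced b e d f" "a \<noteq> c"
  shows "a = e"
  using assms unfolding balanced_def by auto

lemma sum_split_two:
  fixes f :: "nat \<Rightarrow> nat"
  assumes "2 \<le> s"
  shows "(\<Sum>i<s. f i) = f 0 + f 1 + (\<Sum>i\<in>{2..<s}. f i)"
proof -
  have "{..<s} = insert 0 (insert 1 {2..<s})" using assms by auto
  then show ?thesis by simp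
qed

text \<open>
  A truncated inclusion-exclusion: \<open>N \<le> 1 + (N choose 2)\<close> for the number \<open>N\<close> of events that occur.
\<close>

lemma count_le_pairs:
  fixes m :: nat
  shows "(\<Sum>i<m. of_bool (b i)) \<le> (1::real) + (\<Sum>i<m. \<Sum>j<i. of_bool (b i \<and> b j))"
proof (induction m)
  case (Suc m)
  have "0 \<le> (\<Sum>i<m. \<Sum>j<i. of_bool (b i \<and> b j) :: real)" by (intro sum_nonneg) auto
  with Suc show ?case by (cases "b m") (simp_all del: sum_of_bool_eq)
qed simp

text \<open>
  \<open>G\<close> plays the role of the complement of a family without \<open>s\<close> pairwise disjoint members.
\<close>

locale hitting_family =
  fixes E :: "nat set" and s k :: nat and G :: "nat set set"
  assumes finE: "finite E" and cardE: "card E = s * k + 1" and s3: "3 \<le> s" and k1: "1 \<le> k"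
    and hit: "\<And>P. (\<And>i. i < s \<Longrightarrow> P i \<in> ksets E k) \<Longrightarrow> disjoint_family_on P {..<s} \<Longrightarrow> \<exists>i<s. P i \<in> G"
begin

definition excess :: real where
  "excess = real s * freq (ksets E k) (\<lambda>A. A \<in> G) - 1"

text \<open>
  From here on the \<open>k\<close>-sets are fixed and \<open>\<sigma>\<close> is random. A probability then depends only on the sizes
  of the intersections of the sets involved.
\<close>

definition hits :: "(nat \<Rightarrow> nat) \<Rightarrow> nat set \<Rightarrow> bool" where
  "hits \<sigma> A \<longleftrightarrow> \<sigma> ` A \<in> G"

abbreviation pr :: "((nat \<Rightarrow> nat) \<Rightarrow> bool) \<Rightarrow> real" where
  "pr Q \<equiv> freq (Perm E) Q"

lemma Perm_fin_ne: "finite (Perm E)" "Perm E \<noteq> {}"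
  using finite_Perm [OF finE] Perm_nonempty by auto

lemma disjoint_family_perm:
  assumes "\<sigma> \<in> Perm E" "disjoint_family_on P I"
  shows "disjoint_family_on (\<lambda>i. \<sigma> ` P i) I"
  using assms(2) image_Int [OF Perm_inj [OF assms(1)], symmetric]
  unfolding disjoint_family_on_def by simp

lemma hits_once:
  assumes P: "\<And>i. i < s \<Longrightarrow> P i \<in> ksets E k" "disjoint_family_on P {..<s}"
  shows "pr (\<lambda>\<sigma>. (\<Sum>i<s. of_bool (hits \<sigma> (P i))) \<noteq> (1::nat)) \<le> excess"
  unfolding hits_def excess_def
proof (rule hitting_density [OF finE P(1)])
  fix \<sigma> assume "\<sigma> \<in> Perm E"
  with P show "\<exists>i<s. \<sigma> ` P i \<in> G"
    by (intro hit disjoint_family_perm) (auto simp: ksets_image)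
qed

lemma obtain_packing:
  obtains P where "\<And>i. i < s \<Longrightarrow> P i \<in> ksets E k" "disjoint_family_on P {..<s}"
  using obtain_disjoint_ksets [of E s k] finE cardE by auto

lemma excess_nonneg: "0 \<le> excess"
proof -
  obtain P where "\<And>i. i < s \<Longrightarrow> P i \<in> ksets E k" "disjoint_family_on P {..<s}"
    by (rule obtain_packing) blast
  from order_trans [OF freq_nonneg hits_once [OF this]] show ?thesis .
qed

text \<open>
  Complete \<open>A\<close> to a packing that leaves exactly \<open>x\<close> uncovered. Exchanging \<open>a\<close> for \<open>x\<close> does not touch the other
  blocks, and both packings almost always have exactly one block in \<open>G\<close>.
\<close>

lemma hits_swap:
  assumes A: "A \<in> ksets E k" and a: "a \<in> A" and x: "x \<in> E" "x \<notin> A"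
  shows "pr (\<lambda>\<sigma>. hits \<sigma> A \<noteq> hits \<sigma> (insert x (A - {a}))) \<le> 2 * excess"
proof -
  let ?A' = "insert x (A - {a})"
  have AE: "A \<subseteq> E" "finite A" "card A = k" using A finE by (auto simp: ksets_def finite_subset)
  have A': "?A' \<in> ksets E k" using AE a x k1 by (auto simp: ksets_def)
  have "card (E - insert x A) = card E - card (insert x A)"
    using AE x by (intro card_Diff_subset) auto
  then have "(s - 1) * k \<le> card (E - insert x A)"
    using AE x cardE by (simp add: diff_mult_distrib)
  then obtain Q where Q: "\<And>i. i < s - 1 \<Longrightarrow> Q i \<in> ksets (E - insert x A) k" "disjoint_family_on Q {..<s - 1}"
    using obtain_disjoint_ksets [of "E - insert x A" "s - 1" k] finE by blast
  define P where "P B i = (if i = 0 then B else Q (i - 1))" for B and i :: nat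
  have once: "pr (\<lambda>\<sigma>. (\<Sum>i<s. of_bool (hits \<sigma> (P B i))) \<noteq> (1::nat)) \<le> excess"
    if B: "B \<in> ksets E k" "B \<subseteq> insert x A" for B
  proof (rule hits_once)
    have Q1: "Q (i - 1) \<in> ksets E k \<and> Q (i - 1) \<inter> B = {}" if "i < s" "i \<noteq> 0" for i
    proof -
      have "i - 1 < s - 1" using that by arith
      from Q(1) [OF this] B(2) show ?thesis by (auto simp: ksets_def)
    qed
    show "P B i \<in> ksets E k" if "i < s" for i
      using Q1 [OF that] B(1) by (auto simp: P_def)
    show "disjoint_family_on (P B) {..<s}"
      unfolding disjoint_family_on_def
    proof (intro ballI impI)
      fix i j assume ij: "i \<in> {..<s}" "j \<in> {..<s}" "i \<noteq> j"
      show "P B i \<inter> P B j = {}"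
      proof (cases "i = 0 \<or> j = 0")
        case False
        then have "i - 1 \<in> {..<s - 1}" "j - 1 \<in> {..<s - 1}" "i - 1 \<noteq> j - 1" using ij by auto
        with Q(2) have "Q (i - 1) \<inter> Q (j - 1) = {}" unfolding disjoint_family_on_def by blast
        then show ?thesis using False by (simp add: P_def)
      qed (use ij Q1 [of i] Q1 [of j] in \<open>auto simp: P_def\<close>)
    qed
  qed
  have "hits \<sigma> A = hits \<sigma> ?A'"
    if *: "(\<Sum>i<s. of_bool (hits \<sigma> (P A i))) = (1::nat)"
          "(\<Sum>i<s. of_bool (hits \<sigma> (P ?A' i))) = (1::nat)" for \<sigma>
  proof -
    have split: "(\<Sum>i<s. of_bool (hits \<sigma> (P B i)))
        = of_bool (hits \<sigma> B) + (\<Sum>i\<in>{1..<s}. of_bool (hits \<sigma> (Q (i - 1))) :: nat)" for B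
    proof -
      have "{..<s} = insert 0 {1..<s}" using s3 by auto
      then have "(\<Sum>i<s. of_bool (hits \<sigma> (P B i)))
          = of_bool (hits \<sigma> (P B 0)) + (\<Sum>i\<in>{1..<s}. of_bool (hits \<sigma> (P B i)) :: nat)"
        by (simp del: sum_of_bool_eq)
      also have "P B 0 = B" by (simp add: P_def)
      also have "(\<Sum>i\<in>{1..<s}. of_bool (hits \<sigma> (P B i)) :: nat) = (\<Sum>i\<in>{1..<s}. of_bool (hits \<sigma> (Q (i - 1))))"
        by (rule sum.cong) (auto simp: P_def)
      finally show ?thesis .
    qed
    have "of_bool (hits \<sigma> A) = (of_bool (hits \<sigma> ?A') :: nat)"
      using * unfolding split by linarith
    then show ?thesis by (simp only: of_bool_eq_iff)
  qed
  then have "pr (\<lambda>\<sigma>. hits \<sigma> A \<noteq> hits \<sigma> ?A')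
     \<le> pr (\<lambda>\<sigma>. (\<Sum>i<s. of_bool (hits \<sigma> (P A i))) \<noteq> (1::nat))
       + pr (\<lambda>\<sigma>. (\<Sum>i<s. of_bool (hits \<sigma> (P ?A' i))) \<noteq> (1::nat))"
    by (intro freq_le2) blast
  also have "\<dots> \<le> excess + excess"
    using a by (intro add_mono once A A') auto
  finally show ?thesis by simp
qed

lemma hits_path:
  assumes "A \<in> ksets E k" "B \<in> ksets E k"
  shows "pr (\<lambda>\<sigma>. hits \<sigma> A \<noteq> hits \<sigma> B) \<le> 2 * real (card (A - B)) * excess"
  using assms(1)
proof (induction "card (A - B)" arbitrary: A)
  case 0
  have fin: "finite A" "finite B" "card A = card B"
    using 0 assms(2) finE by (auto simp: ksets_def finite_subset)
  then have "A \<subseteq> B" using 0 by simp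
  then have "A = B" using fin card_subset_eq by blast
  then show ?case by (simp add: freq_def avg_def)
next
  case (Suc d)
  have fin: "finite A" "finite B" "card A = card B" "A \<subseteq> E" "B \<subseteq> E"
    using Suc.prems assms(2) finE by (auto simp: ksets_def finite_subset)
  have "card (B - A) = card (A - B)"
    using fin card_Diff_subset_Int [of A B] card_Diff_subset_Int [of B A] by (simp add: Int_commute)
  then have "card (A - B) \<noteq> 0" "card (B - A) \<noteq> 0" using Suc.hyps(2) by linarith+
  then have "A - B \<noteq> {}" "B - A \<noteq> {}" by (auto simp only: card.empty)
  then obtain a x where ax: "a \<in> A" "a \<notin> B" "x \<in> B" "x \<notin> A" by blast
  let ?A' = "insert x (A - {a})"
  have A': "?A' \<in> ksets E k" using Suc.prems fin ax k1 by (auto simp: ksets_def)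
  have "?A' - B = (A - B) - {a}" using ax by auto
  then have "card (?A' - B) = d" using Suc.hyps(2) ax fin by simp
  have "pr (\<lambda>\<sigma>. hits \<sigma> A \<noteq> hits \<sigma> B)
      \<le> pr (\<lambda>\<sigma>. hits \<sigma> A \<noteq> hits \<sigma> ?A') + pr (\<lambda>\<sigma>. hits \<sigma> ?A' \<noteq> hits \<sigma> B)"
    by (rule freq_le2) blast
  also have "\<dots> \<le> 2 * excess + 2 * real (card (?A' - B)) * excess"
    using Suc.hyps(1) [OF \<open>card (?A' - B) = d\<close> [symmetric] A'] hits_swap [OF Suc.prems ax(1) _ ax(4)] ax(3) fin
    by (intro add_mono) auto
  finally show ?case
    unfolding Suc.hyps(2) [symmetric] \<open>card (?A' - B) = d\<close> by (simp add: algebra_simps)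
qed

text \<open>
  If all blocks of a packing had the same status, the number of blocks in \<open>G\<close> would be \<open>0\<close> or \<open>s\<close> and not
  one. But \<open>k\<close> single exchanges lead from one block to any other, and each rarely changes the status.
\<close>

lemma excess_lower_bound: "1 \<le> (1 + 2 * real s * real k) * excess"
proof -
  obtain P where P: "\<And>i. i < s \<Longrightarrow> P i \<in> ksets E k" "disjoint_family_on P {..<s}"
    by (rule obtain_packing) blast
  have s0: "0 < s" using s3 by simp
  have ex: "\<exists>i\<in>{1..<s}. hits \<sigma> (P 0) \<noteq> hits \<sigma> (P i)"
    if "(\<Sum>i<s. of_bool (hits \<sigma> (P i))) = (1::nat)" for \<sigma>
  proof (rule ccontr)
    assume "\<not> ?thesis"
    then have same: "hits \<sigma> (P i) = hits \<sigma> (P 0)" if "i < s" for i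
      using that by (cases "i = 0") auto
    have "(\<Sum>i<s. of_bool (hits \<sigma> (P i))) = (\<Sum>i<s. of_bool (hits \<sigma> (P 0)) :: nat)"
    proof (rule sum.cong)
      fix i assume "i \<in> {..<s}"
      then show "of_bool (hits \<sigma> (P i)) = (of_bool (hits \<sigma> (P 0)) :: nat)"
        using same [of i] by simp
    qed simp
    with that show False using s3 by (auto simp: of_bool_def split: if_splits)
  qed
  have "1 = pr (\<lambda>\<sigma>. True)" using freq_True [OF Perm_fin_ne] by simp
  also have "\<dots> \<le> pr (\<lambda>\<sigma>. (\<Sum>i<s. of_bool (hits \<sigma> (P i))) \<noteq> (1::nat))
        + pr (\<lambda>\<sigma>. \<exists>i\<in>{1..<s}. hits \<sigma> (P 0) \<noteq> hits \<sigma> (P i))"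
    by (rule freq_le2) (use ex in blast)
  also have "\<dots> \<le> excess + (\<Sum>i\<in>{1..<s}. pr (\<lambda>\<sigma>. hits \<sigma> (P 0) \<noteq> hits \<sigma> (P i)))"
    by (intro add_mono hits_once P freq_Bex) auto
  also have "\<dots> \<le> excess + (\<Sum>i\<in>{1..<s}. 2 * real k * excess)"
  proof (intro add_left_mono sum_mono)
    fix i assume i: "i \<in> {1..<s}"
    have "P 0 \<in> ksets E k" using P(1) s0 .
    then have "card (P 0 - P i) \<le> k"
      using finE card_mono [of "P 0" "P 0 - P i"] by (auto simp: ksets_def finite_subset)
    then have "2 * real (card (P 0 - P i)) * excess \<le> 2 * real k * excess"
      using excess_nonneg by (intro mult_right_mono) auto
    with hits_path [OF P(1) [OF s0] P(1), of i] i
    show "pr (\<lambda>\<sigma>. hits \<sigma> (P 0) \<noteq> hits \<sigma> (P i)) \<le> 2 * real k * excess" by auto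
  qed
  also have "\<dots> \<le> excess + real s * (2 * real k * excess)"
    using excess_nonneg by (simp add: mult_right_mono)
  finally show ?thesis by (simp add: algebra_simps)
qed

lemma extend_two:
  assumes A: "A \<in> ksets E k" "B \<in> ksets E k" "A \<inter> B = {}"
  obtains Q where "\<And>i. 2 \<le> i \<Longrightarrow> i < s \<Longrightarrow> Q i \<in> ksets E k" "\<And>i. 2 \<le> i \<Longrightarrow> i < s \<Longrightarrow> Q i \<inter> (A \<union> B) = {}"
    "disjoint_family_on Q {2..<s}"
proof -
  have fin: "finite A" "finite B" and sub: "A \<subseteq> E" "B \<subseteq> E" and card: "card A = k" "card B = k"
    using A finE by (auto simp: ksets_def finite_subset)
  have "card (E - (A \<union> B)) = s * k + 1 - 2 * k"
    using fin sub card A(3) cardE by (simp add: card_Diff_subset card_Un_disjoint)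
  then have "(s - 2) * k \<le> card (E - (A \<union> B))" by (simp add: diff_mult_distrib)
  then obtain Q where Q: "\<And>i. i < s - 2 \<Longrightarrow> Q i \<in> ksets (E - (A \<union> B)) k" "disjoint_family_on Q {..<s - 2}"
    using obtain_disjoint_ksets [of "E - (A \<union> B)" "s - 2" k] finE by blast
  show thesis
  proof (rule that [of "\<lambda>i. Q (i - 2)"])
    show "Q (i - 2) \<in> ksets E k" "Q (i - 2) \<inter> (A \<union> B) = {}" if "2 \<le> i" "i < s" for i
    proof -
      have "i - 2 < s - 2" using that by arith
      from Q(1) [OF this] show "Q (i - 2) \<in> ksets E k" "Q (i - 2) \<inter> (A \<union> B) = {}"
        by (auto simp: ksets_def)
    qed
    show "disjoint_family_on (\<lambda>i. Q (i - 2)) {2..<s}"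
      unfolding disjoint_family_on_def
    proof (intro ballI impI)
      fix i j assume "i \<in> {2..<s}" "j \<in> {2..<s}" "i \<noteq> j"
      then have "i - 2 \<in> {..<s - 2}" "j - 2 \<in> {..<s - 2}" "i - 2 \<noteq> j - 2" by auto
      with Q(2) show "Q (i - 2) \<inter> Q (j - 2) = {}" unfolding disjoint_family_on_def by blast
    qed
  qed
qed

text \<open>
  The sets \<open>X \<union> Y\<close>, \<open>X' \<union> Y'\<close> and the sets \<open>X \<union> Y'\<close>, \<open>X' \<union> Y\<close> are completed to packings by the same further
  blocks, and both packings almost always have exactly one block in \<open>G\<close>.
\<close>

lemma hits_balanced:
  assumes X: "X \<subseteq> E" "X' \<subseteq> E" "card X = x" "card X' = x"
    and Y: "Y \<subseteq> E" "Y' \<subseteq> E" "card Y + x = k" "card Y' + x = k"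
    and dis: "X \<inter> X' = {}" "Y \<inter> Y' = {}" "(X \<union> X') \<inter> (Y \<union> Y') = {}"
  shows "pr (\<lambda>\<sigma>. \<not> balanced (hits \<sigma> (X \<union> Y)) (hits \<sigma> (X \<union> Y')) (hits \<sigma> (X' \<union> Y)) (hits \<sigma> (X' \<union> Y')))
          \<le> 2 * excess"
proof -
  have fin: "finite X" "finite X'" "finite Y" "finite Y'"
    using X Y finE finite_subset by auto
  have ks: "X \<union> Y \<in> ksets E k" "X' \<union> Y' \<in> ksets E k" "X \<union> Y' \<in> ksets E k" "X' \<union> Y \<in> ksets E k"
    unfolding ksets_def using X Y dis fin by (auto simp: card_Un_disjoint Int_Un_distrib Int_Un_distrib2)
  have "(X \<union> Y) \<inter> (X' \<union> Y') = {}" using dis by auto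
  from extend_two [OF ks(1,2) this] obtain Q where Q: "\<And>i. 2 \<le> i \<Longrightarrow> i < s \<Longrightarrow> Q i \<in> ksets E k"
    "\<And>i. 2 \<le> i \<Longrightarrow> i < s \<Longrightarrow> Q i \<inter> ((X \<union> Y) \<union> (X' \<union> Y')) = {}" "disjoint_family_on Q {2..<s}" by blast
  define P where "P A B i = (if i = 0 then A else if i = 1 then B else Q i)" for A B and i :: nat
  have once: "pr (\<lambda>\<sigma>. (\<Sum>i<s. of_bool (hits \<sigma> (P A B i))) \<noteq> (1::nat)) \<le> excess"
    if AB: "A \<in> ksets E k" "B \<in> ksets E k" "A \<inter> B = {}" "A \<union> B = (X \<union> Y) \<union> (X' \<union> Y')" for A B
  proof (rule hits_once)
    show "P A B i \<in> ksets E k" if "i < s" for i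
      using that AB Q(1) [of i] by (auto simp: P_def)
    have Q2: "Q i \<inter> A = {} \<and> Q i \<inter> B = {}" if "2 \<le> i" "i < s" for i
      using Q(2) [OF that] AB(4) by auto
    show "disjoint_family_on (P A B) {..<s}"
      unfolding disjoint_family_on_def
    proof (intro ballI impI)
      fix i j assume ij: "i \<in> {..<s}" "j \<in> {..<s}" "i \<noteq> j"
      consider "i < 2" "j < 2" | "i < 2" "2 \<le> j" | "2 \<le> i" "j < 2" | "2 \<le> i" "2 \<le> j" by linarith
      then show "P A B i \<inter> P A B j = {}"
      proof cases
        case 4
        then show ?thesis using Q(3) ij by (auto simp: P_def disjoint_family_on_def)
      qed (use ij AB(3) Q2 [of i] Q2 [of j] in \<open>auto simp: P_def less_2_cases_iff\<close>)
    qed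
  qed
  have 1: "pr (\<lambda>\<sigma>. (\<Sum>i<s. of_bool (hits \<sigma> (P (X \<union> Y) (X' \<union> Y') i))) \<noteq> (1::nat)) \<le> excess"
    by (rule once) (use ks dis in auto)
  have 2: "pr (\<lambda>\<sigma>. (\<Sum>i<s. of_bool (hits \<sigma> (P (X \<union> Y') (X' \<union> Y) i))) \<noteq> (1::nat)) \<le> excess"
    by (rule once) (use ks dis in auto)
  have "balanced (hits \<sigma> (X \<union> Y)) (hits \<sigma> (X \<union> Y')) (hits \<sigma> (X' \<union> Y)) (hits \<sigma> (X' \<union> Y'))"
    if *: "(\<Sum>i<s. of_bool (hits \<sigma> (P (X \<union> Y) (X' \<union> Y') i))) = (1::nat)"
          "(\<Sum>i<s. of_bool (hits \<sigma> (P (X \<union> Y') (X' \<union> Y) i))) = (1::nat)" for \<sigma>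
  proof (rule balanced_exchange)
    have rest: "(\<Sum>i\<in>{2..<s}. of_bool (hits \<sigma> (P A B i))) = (\<Sum>i\<in>{2..<s}. of_bool (hits \<sigma> (Q i)) :: nat)" for A B
      by (rule sum.cong) (auto simp: P_def)
    have s2: "2 \<le> s" using s3 by simp
    show "of_bool (hits \<sigma> (X \<union> Y)) + of_bool (hits \<sigma> (X' \<union> Y')) + (\<Sum>i\<in>{2..<s}. of_bool (hits \<sigma> (Q i))) = (1::nat)"
      using *(1) unfolding sum_split_two [OF s2] rest by (simp add: P_def)
    show "of_bool (hits \<sigma> (X \<union> Y')) + of_bool (hits \<sigma> (X' \<union> Y)) + (\<Sum>i\<in>{2..<s}. of_bool (hits \<sigma> (Q i))) = (1::nat)"
      using *(2) unfolding sum_split_two [OF s2] rest by (simp add: P_def)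
  qed
  then have "pr (\<lambda>\<sigma>. \<not> balanced (hits \<sigma> (X \<union> Y)) (hits \<sigma> (X \<union> Y')) (hits \<sigma> (X' \<union> Y)) (hits \<sigma> (X' \<union> Y')))
     \<le> pr (\<lambda>\<sigma>. (\<Sum>i<s. of_bool (hits \<sigma> (P (X \<union> Y) (X' \<union> Y') i))) \<noteq> (1::nat))
       + pr (\<lambda>\<sigma>. (\<Sum>i<s. of_bool (hits \<sigma> (P (X \<union> Y') (X' \<union> Y) i))) \<noteq> (1::nat))"
    by (intro freq_le2) blast
  with 1 2 show ?thesis by simp
qed

text \<open>
  The sets \<open>Y\<close> and \<open>Y''\<close> may overlap. They are linked through a set \<open>Y'\<close> disjoint from both, for which there
  is room because \<open>E\<close> has at least \<open>3 * k\<close> elements.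
\<close>

lemma change_on_one_side:
  assumes X: "X \<subseteq> E" "X' \<subseteq> E" "card X = x" "card X' = x"
    and Y: "Y \<subseteq> E" "Y'' \<subseteq> E" "card Y + x = k" "card Y'' + x = k"
    and dis: "X \<inter> X' = {}" "(X \<union> X') \<inter> (Y \<union> Y'') = {}"
  shows "pr (\<lambda>\<sigma>. hits \<sigma> (X \<union> Y) \<noteq> hits \<sigma> (X' \<union> Y) \<and> hits \<sigma> (X \<union> Y) \<noteq> hits \<sigma> (X \<union> Y''))
          \<le> 4 * excess"
proof -
  have fin: "finite X" "finite X'" "finite Y" "finite Y''"
    using X Y finE finite_subset by auto
  have "card (X \<union> X' \<union> Y \<union> Y'') \<le> card X + card X' + card Y + card Y''"
    using card_Un_le [of "X \<union> X' \<union> Y" Y''] card_Un_le [of "X \<union> X'" Y] card_Un_le [of X X'] by linarith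
  then have "card (X \<union> X' \<union> Y \<union> Y'') \<le> 2 * k" using X Y by simp
  moreover have "3 * k \<le> s * k" using s3 by simp
  moreover have "card (E - (X \<union> X' \<union> Y \<union> Y'')) = card E - card (X \<union> X' \<union> Y \<union> Y'')"
    using X Y fin by (intro card_Diff_subset) auto
  ultimately have "card Y \<le> card (E - (X \<union> X' \<union> Y \<union> Y''))" using cardE Y by linarith
  then obtain Y' where Y': "Y' \<subseteq> E - (X \<union> X' \<union> Y \<union> Y'')" "card Y' = card Y"
    using obtain_subset_with_card_n [of "card Y" "E - (X \<union> X' \<union> Y \<union> Y'')"] by metis
  have Y'E: "Y' \<subseteq> E" "card Y' + x = k" using Y' Y by auto
  have "pr (\<lambda>\<sigma>. hits \<sigma> (X \<union> Y) \<noteq> hits \<sigma> (X' \<union> Y) \<and> hits \<sigma> (X \<union> Y) \<noteq> hits \<sigma> (X \<union> Y''))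
    \<le> pr (\<lambda>\<sigma>. \<not> balanced (hits \<sigma> (X \<union> Y)) (hits \<sigma> (X \<union> Y')) (hits \<sigma> (X' \<union> Y)) (hits \<sigma> (X' \<union> Y')))
      + pr (\<lambda>\<sigma>. \<not> balanced (hits \<sigma> (X \<union> Y')) (hits \<sigma> (X \<union> Y'')) (hits \<sigma> (X' \<union> Y')) (hits \<sigma> (X' \<union> Y'')))"
    by (intro freq_le2) (blast dest: balanced_chain)
  also have "\<dots> \<le> 2 * excess + 2 * excess"
    using Y' dis by (intro add_mono hits_balanced [OF X Y(1) Y'E(1) Y(3) Y'E(2)]
        hits_balanced [OF X Y'E(1) Y(2) Y'E(2) Y(4)]) blast+
  finally show ?thesis by simp
qed

text \<open>
  Choose \<open>m\<close> disjoint parts of \<open>A\<close>, each of the size of \<open>A - A'\<close>, with disjoint replacements. All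
  \<open>m\<close> replacements have the same probability of changing the status of \<open>A\<close>, and by \<open>change_on_one_side\<close> two of
  them rarely do so together. Hence this common probability is hardly larger than \<open>1 / m\<close>.
\<close>

lemma hits_stable:
  assumes A: "A \<in> ksets E k" "A' \<in> ksets E k" and m: "1 \<le> m" "m * card (A - A') \<le> k"
  shows "pr (\<lambda>\<sigma>. hits \<sigma> A \<noteq> hits \<sigma> A') \<le> 1 / real m + 2 * real m * excess"
proof -
  define d where "d = card (A - A')"
  define \<theta> where "\<theta> = pr (\<lambda>\<sigma>. hits \<sigma> A \<noteq> hits \<sigma> A')"
  have AE: "A \<subseteq> E" "finite A" "card A = k" using A finE by (auto simp: ksets_def finite_subset)
  have "3 * k \<le> s * k" using s3 by simp
  moreover have "card (E - A) = card E - card A" using AE by (intro card_Diff_subset) auto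
  ultimately have "k \<le> card (E - A)" using AE(3) cardE by linarith
  then obtain R' where R': "\<And>i. i < m \<Longrightarrow> R' i \<in> ksets (E - A) d" "disjoint_family_on R' {..<m}"
    using obtain_disjoint_ksets [of "E - A" m d] finE m d_def by (metis finite_Diff order_trans)
  obtain R where R: "\<And>i. i < m \<Longrightarrow> R i \<in> ksets A d" "disjoint_family_on R {..<m}"
    using obtain_disjoint_ksets [of A m d] AE m d_def by metis
  \<comment> \<open>The set \<open>B i\<close> is \<open>A\<close> with its \<open>i\<close>-th part replaced.\<close>
  define B where "B i = R' i \<union> (A - R i)" for i
  have Rs: "R i \<subseteq> A" "card (R i) = d" "R' i \<subseteq> E - A" "card (R' i) = d" "finite (R i)" "finite (R' i)"
    "R i \<union> (A - R i) = A" "card (A - R i) + d = k" if "i < m" for i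
  proof -
    show *: "R i \<subseteq> A" "card (R i) = d" "R' i \<subseteq> E - A" "card (R' i) = d"
      using R(1) R'(1) that by (auto simp: ksets_def)
    show **: "finite (R i)" "finite (R' i)"
      using * AE finE by (auto intro: finite_subset)
    show "R i \<union> (A - R i) = A" using * by auto
    show "card (A - R i) + d = k"
      using * ** AE card_mono [of A "R i"] by (simp add: card_Diff_subset)
  qed
  have B: "B i \<in> ksets E k" "A - B i = R i" if "i < m" for i
  proof -
    have "card (B i) = card (R' i) + card (A - R i)"
      unfolding B_def using Rs [OF that] AE by (intro card_Un_disjoint) auto
    then show "B i \<in> ksets E k" "A - B i = R i"
      using Rs [OF that] AE unfolding B_def ksets_def by auto
  qed
  have same: "pr (\<lambda>\<sigma>. hits \<sigma> A \<noteq> hits \<sigma> (B i)) = \<theta>" if "i < m" for i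
    unfolding freq_def \<theta>_def hits_def
    by (rule avg_perm_pair [OF finE A(1) B(1) [OF that] A, of "\<lambda>X Y. of_bool ((X \<in> G) \<noteq> (Y \<in> G))"])
       (use that B(2) Rs(2) d_def in auto)
  have pair: "pr (\<lambda>\<sigma>. hits \<sigma> A \<noteq> hits \<sigma> (B i) \<and> hits \<sigma> A \<noteq> hits \<sigma> (B j)) \<le> 4 * excess"
    if "i < m" "j < i" for i j
  proof -
    have j: "j < m" using that by simp
    have dis: "R i \<inter> R j = {}" "R' i \<inter> R' j = {}"
      using R(2) R'(2) that j unfolding disjoint_family_on_def by auto
    \<comment> \<open>This \<open>Y\<close> turns the \<open>j\<close>-th replacement into an exchange outside the \<open>i\<close>-th part.\<close>
    define Y where "Y = R' j \<union> (A - R i - R j)"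
    have Y: "Y \<subseteq> E" "R i \<union> Y = B j"
      using Rs [OF that(1)] Rs [OF j] AE dis unfolding Y_def B_def by auto
    have "card Y + d = k"
    proof -
      have "R i \<inter> Y = {}" using Rs [OF that(1)] Rs [OF j] unfolding Y_def by auto
      then have "card (B j) = card (R i) + card Y"
        using Y Rs(5) [OF that(1)] finE finite_subset unfolding Y(2) [symmetric]
        by (intro card_Un_disjoint) auto
      then show ?thesis using B(1) [OF j] Rs(2) [OF that(1)] unfolding ksets_def by simp
    qed
    moreover have "R i \<inter> R' i = {}" "(R i \<union> R' i) \<inter> ((A - R i) \<union> Y) = {}"
      using Rs [OF that(1)] Rs [OF j] dis unfolding Y_def by auto
    ultimately have "pr (\<lambda>\<sigma>. hits \<sigma> (R i \<union> (A - R i)) \<noteq> hits \<sigma> (R' i \<union> (A - R i))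
           \<and> hits \<sigma> (R i \<union> (A - R i)) \<noteq> hits \<sigma> (R i \<union> Y)) \<le> 4 * excess"
      using Rs [OF that(1)] AE Y by (intro change_on_one_side) auto
    then show ?thesis using Rs(7) [OF that(1)] Y(2) by (simp add: B_def)
  qed
  have "real m * \<theta> = (\<Sum>i<m. pr (\<lambda>\<sigma>. hits \<sigma> A \<noteq> hits \<sigma> (B i)))"
    using same by simp
  also have "\<dots> = avg (Perm E) (\<lambda>\<sigma>. \<Sum>i<m. of_bool (hits \<sigma> A \<noteq> hits \<sigma> (B i)))"
    unfolding freq_def by (rule avg_sum [symmetric])
  also have "\<dots> \<le> avg (Perm E) (\<lambda>\<sigma>. 1 + (\<Sum>i<m. \<Sum>j<i. of_bool (hits \<sigma> A \<noteq> hits \<sigma> (B i) \<and> hits \<sigma> A \<noteq> hits \<sigma> (B j))))"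
    by (intro avg_mono count_le_pairs)
  also have "\<dots> = 1 + (\<Sum>i<m. \<Sum>j<i. pr (\<lambda>\<sigma>. hits \<sigma> A \<noteq> hits \<sigma> (B i) \<and> hits \<sigma> A \<noteq> hits \<sigma> (B j)))"
    unfolding avg_add avg_sum freq_def using avg_const [OF Perm_fin_ne] by simp
  also have "\<dots> \<le> 1 + (\<Sum>i<m. \<Sum>j<i. 4 * excess)"
    using pair by (intro add_left_mono sum_mono) auto
  also have "(\<Sum>i<m. \<Sum>j<i. 4 * excess) = 4 * excess * (\<Sum>i<m. real i)"
    by (simp add: sum_distrib_right mult.commute)
  also have "4 * excess * (\<Sum>i<m. real i) \<le> 4 * excess * (real m * real m / 2)"
  proof (rule mult_left_mono)
    show "(\<Sum>i<m. real i) \<le> real m * real m / 2"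
      by (induction m) (auto simp: field_simps)
  qed (use excess_nonneg in simp)
  finally have "real m * \<theta> \<le> 1 + 2 * excess * real m * real m" by (simp add: algebra_simps)
  then have "\<theta> \<le> (1 + 2 * excess * real m * real m) / real m"
    using m(1) by (simp add: pos_le_divide_eq mult.commute)
  also have "\<dots> = 1 / real m + 2 * real m * excess" using m(1) by (simp add: add_divide_distrib)
  finally show ?thesis unfolding \<theta>_def .
qed

end

section \<open>Functions accepting one class of a colouring depend on one coordinate\<close>

lemma bij_betw_map_prod:
  assumes "bij_betw f A A'" "bij_betw g B B'"
  shows "bij_betw (map_prod f g) (A \<times> B) (A' \<times> B')"
  using assms unfolding bij_betw_def by (simp add: map_prod_inj_on map_prod_surj_on)

lemma avg_multc: "avg S (\<lambda>x. f x * c) = avg S f * c"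
  unfolding avg_def by (simp add: sum_distrib_right)

lemma avg_rotate:
  "avg A (\<lambda>x. avg B (\<lambda>y. avg C (\<lambda>z. f x y z))) = avg C (\<lambda>z. avg A (\<lambda>x. avg B (\<lambda>y. f x y z)))"
proof -
  have "avg A (\<lambda>x. avg B (\<lambda>y. avg C (\<lambda>z. f x y z))) = avg A (\<lambda>x. avg C (\<lambda>z. avg B (\<lambda>y. f x y z)))"
    by (rule avg_cong) (rule avg_swap)
  also have "\<dots> = avg C (\<lambda>z. avg A (\<lambda>x. avg B (\<lambda>y. f x y z)))"
    by (rule avg_swap)
  finally show ?thesis .
qed

text \<open>
  Colourings are words over \<open>{..<s}\<close> with positions in \<open>I\<close>. A shuffle permutes the colours separately at
  each position; the constant words are turned by it into \<open>s\<close> words that pairwise differ everywhere.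
\<close>

definition act :: "nat set \<Rightarrow> (nat \<Rightarrow> nat \<Rightarrow> nat) \<Rightarrow> (nat \<Rightarrow> nat) \<Rightarrow> nat \<Rightarrow> nat" where
  "act I \<pi> y = (\<lambda>c\<in>I. \<pi> c (y c))"

definition mix :: "nat set \<Rightarrow> (nat \<Rightarrow> nat) \<Rightarrow> (nat \<Rightarrow> nat) \<Rightarrow> nat \<Rightarrow> nat" where
  "mix U y z = (\<lambda>c. if c \<in> U then y c else z c)"

text \<open>
  Of the 2-by-2 table with rows \<open>a b\<close> and \<open>c d\<close>, the entry depends on the row only or on the
  column only.
\<close>

definition flat :: "bool \<Rightarrow> bool \<Rightarrow> bool \<Rightarrow> bool \<Rightarrow> bool" where
  "flat a b c d \<longleftrightarrow> a = b \<and> c = d \<or> a = c \<and> b = d"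

lemma flat_from_balanced:
  assumes "balanced a p r t" "balanced b p q t" "balanced c p' r t" "balanced d p' q t"
  shows "flat a b c d"
  using assms unfolding balanced_def flat_def by blast

lemma exists_perm_two_values:
  assumes "a < s" "b < s" "a \<noteq> b"
  shows "\<exists>p\<in>Perm {..<s}. p 0 = a \<and> p 1 = b"
proof (intro bexI conjI)
  let ?t = "transpose (0::nat) a"
  let ?p = "transpose (?t 1) b \<circ> ?t"
  have t1: "?t 1 \<noteq> a" "?t 1 < s" using assms by (auto simp: transpose_def)
  show "?p \<in> Perm {..<s}"
    unfolding Perm_def using assms t1
    by (auto intro!: permutes_compose permutes_swap_id)
  show "?p 0 = a" using t1 assms by (simp add: transpose_def)
  show "?p 1 = b" by simp
qed

locale colour_words =
  fixes I :: "nat set" and s :: nat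
  assumes finI: "finite I" and s3: "3 \<le> s"
begin

definition Words :: "(nat \<Rightarrow> nat) set" where
  "Words = I \<rightarrow>\<^sub>E {..<s}"

definition Shuffles :: "(nat \<Rightarrow> nat \<Rightarrow> nat) set" where
  "Shuffles = I \<rightarrow>\<^sub>E Perm {..<s}"

lemma Words_fin_ne: "finite Words" "Words \<noteq> {}"
proof -
  show "finite Words" using finI unfolding Words_def by (simp add: finite_PiE)
  have "(\<lambda>c\<in>I. 0) \<in> Words" using s3 by (auto simp: Words_def)
  then show "Words \<noteq> {}" by blast
qed

lemma Shuffles_fin_ne: "finite Shuffles" "Shuffles \<noteq> {}"
  using finI finite_Perm [of "{..<s}"] Perm_nonempty unfolding Shuffles_def
  by (auto intro!: finite_PiE simp: PiE_eq_empty_iff)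

lemma act_cong: "(\<And>c. c \<in> I \<Longrightarrow> y c = z c) \<Longrightarrow> act I \<pi> y = act I \<pi> z"
  unfolding act_def by auto

lemma act_Words: "\<pi> \<in> Shuffles \<Longrightarrow> y \<in> Words \<Longrightarrow> act I \<pi> y \<in> Words"
  unfolding act_def Words_def Shuffles_def Perm_def
  by (auto simp: PiE_iff permutes_in_image)
    (metis lessThan_iff permutes_in_image)

lemma bij_betw_act:
  assumes "\<pi> \<in> Shuffles"
  shows "bij_betw (act I \<pi>) Words Words"
proof (rule bij_betwI [where g = "act I (\<lambda>c\<in>I. inv (\<pi> c))"])
  have perm: "\<pi> c permutes {..<s}" if "c \<in> I" for c
    using assms that by (auto simp: Shuffles_def Perm_def PiE_iff)
  have inv: "(\<lambda>c\<in>I. inv (\<pi> c)) \<in> Shuffles"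
    using perm by (auto simp: Shuffles_def Perm_def permutes_inv)
  show "act I \<pi> \<in> Words \<rightarrow> Words" "act I (\<lambda>c\<in>I. inv (\<pi> c)) \<in> Words \<rightarrow> Words"
    using act_Words assms inv by auto
  fix y assume "y \<in> Words"
  then have ext: "y c = undefined" if "c \<notin> I" for c
    using that by (auto simp: Words_def PiE_iff extensional_def)
  show "act I (\<lambda>c\<in>I. inv (\<pi> c)) (act I \<pi> y) = y" "act I \<pi> (act I (\<lambda>c\<in>I. inv (\<pi> c)) y) = y"
    using permutes_inverses [OF perm] ext by (auto simp: act_def fun_eq_iff)
qed

lemma avg_Shuffles_right:
  assumes "\<pi>\<^sub>0 \<in> Shuffles"
  shows "avg Shuffles (\<lambda>\<pi>. f (\<lambda>c\<in>I. \<pi> c \<circ> \<pi>\<^sub>0 c)) = avg Shuffles f"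
proof -
  have perm: "\<pi>\<^sub>0 c permutes {..<s}" if "c \<in> I" for c
    using assms that by (auto simp: Shuffles_def Perm_def PiE_iff)
  have "bij_betw (\<lambda>\<pi>. \<lambda>c\<in>I. \<pi> c \<circ> \<pi>\<^sub>0 c) Shuffles Shuffles"
  proof (rule bij_betwI [where g = "\<lambda>\<pi>. \<lambda>c\<in>I. \<pi> c \<circ> inv (\<pi>\<^sub>0 c)"])
    show "(\<lambda>\<pi>. \<lambda>c\<in>I. \<pi> c \<circ> \<pi>\<^sub>0 c) \<in> Shuffles \<rightarrow> Shuffles"
      "(\<lambda>\<pi>. \<lambda>c\<in>I. \<pi> c \<circ> inv (\<pi>\<^sub>0 c)) \<in> Shuffles \<rightarrow> Shuffles"
      using perm by (auto simp: Shuffles_def Perm_def PiE_iff intro!: permutes_compose permutes_inv)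
    fix \<pi> assume "\<pi> \<in> Shuffles"
    then have ext: "\<pi> c = undefined" if "c \<notin> I" for c
      using that by (auto simp: Shuffles_def PiE_iff extensional_def)
    show "(\<lambda>c\<in>I. (\<lambda>c\<in>I. \<pi> c \<circ> \<pi>\<^sub>0 c) c \<circ> inv (\<pi>\<^sub>0 c)) = \<pi>"
      "(\<lambda>c\<in>I. (\<lambda>c\<in>I. \<pi> c \<circ> inv (\<pi>\<^sub>0 c)) c \<circ> \<pi>\<^sub>0 c) = \<pi>"
    proof -
      show "(\<lambda>c\<in>I. (\<lambda>c\<in>I. \<pi> c \<circ> \<pi>\<^sub>0 c) c \<circ> inv (\<pi>\<^sub>0 c)) = \<pi>"
      proof
        fix c show "(\<lambda>c\<in>I. (\<lambda>c\<in>I. \<pi> c \<circ> \<pi>\<^sub>0 c) c \<circ> inv (\<pi>\<^sub>0 c)) c = \<pi> c"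
          using perm [of c] ext [of c] by (cases "c \<in> I") (auto simp: o_assoc [symmetric] permutes_inv_o)
      qed
      show "(\<lambda>c\<in>I. (\<lambda>c\<in>I. \<pi> c \<circ> inv (\<pi>\<^sub>0 c)) c \<circ> \<pi>\<^sub>0 c) = \<pi>"
      proof
        fix c show "(\<lambda>c\<in>I. (\<lambda>c\<in>I. \<pi> c \<circ> inv (\<pi>\<^sub>0 c)) c \<circ> \<pi>\<^sub>0 c) c = \<pi> c"
          using perm [of c] ext [of c] by (cases "c \<in> I") (auto simp: o_assoc [symmetric] permutes_inv_o)
      qed
    qed
  qed
  from avg_reindex [OF this, of f] show ?thesis by simp
qed

lemma mix_Words: "y \<in> Words \<Longrightarrow> z \<in> Words \<Longrightarrow> mix U y z \<in> Words"
  unfolding Words_def mix_def by (auto simp: PiE_iff extensional_def)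

lemma act_mix: "act I \<pi> (mix U y z) = mix U (act I \<pi> y) (act I \<pi> z)"
  unfolding act_def mix_def by auto

text \<open>
  Exchanging the restrictions to \<open>U\<close> of two independent uniform words is an involution, so the results
  are again independent and uniform.
\<close>

lemma avg_mix:
  "avg (Words \<times> Words) (\<lambda>(y, z). f (mix U y z) (mix U z y)) = avg (Words \<times> Words) (\<lambda>(y, z). f y z)"
proof -
  have "bij_betw (\<lambda>(y, z). (mix U y z, mix U z y)) (Words \<times> Words) (Words \<times> Words)"
  proof (rule bij_betwI [where g = "\<lambda>(y, z). (mix U y z, mix U z y)"])
  qed (auto simp: mix_Words, auto simp: mix_def)
  from avg_reindex [OF this, of "\<lambda>(y, z). f y z"] show ?thesis
    by (simp add: case_prod_unfold)
qed

end

text \<open>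
  A word is accepted if \<open>\<phi>\<close> holds for it; of \<open>s\<close> random words that pairwise differ everywhere, exactly one
  is accepted up to probability \<open>d\<close>.
\<close>

locale exact_colouring = colour_words +
  fixes \<phi> :: "(nat \<Rightarrow> nat) \<Rightarrow> bool" and d :: real
  assumes once: "freq Shuffles (\<lambda>\<pi>. (\<Sum>i<s. of_bool (\<phi> (act I \<pi> (\<lambda>c. i)))) \<noteq> (1::nat)) \<le> d"
begin

lemma once_shuffled:
  assumes "\<pi>\<^sub>0 \<in> Shuffles"
  shows "freq Shuffles (\<lambda>\<pi>. (\<Sum>i<s. of_bool (\<phi> (act I \<pi> (act I \<pi>\<^sub>0 (\<lambda>c. i))))) \<noteq> (1::nat)) \<le> d"
proof -
  have "act I (\<lambda>c\<in>I. \<pi> c \<circ> \<pi>\<^sub>0 c) y = act I \<pi> (act I \<pi>\<^sub>0 y)" for \<pi> y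
    unfolding act_def by auto
  then show ?thesis
    using once avg_Shuffles_right [OF assms,
        of "\<lambda>\<pi>. of_bool ((\<Sum>i<s. of_bool (\<phi> (act I \<pi> (\<lambda>c. i)))) \<noteq> (1::nat))"]
    unfolding freq_def by simp
qed

text \<open>
  The words \<open>y\<close>, \<open>y'\<close> are the images of the constant words \<open>0\<close> and \<open>1\<close> under a shuffle, and so are the two
  mixtures, under a shuffle that agrees with the first one on all other constant words.
\<close>

lemma words_balanced:
  assumes y: "\<And>c. c \<in> I \<Longrightarrow> y c < s" "\<And>c. c \<in> I \<Longrightarrow> y' c < s" "\<And>c. c \<in> I \<Longrightarrow> y c \<noteq> y' c"
  shows "freq Shuffles (\<lambda>\<pi>. \<not> balanced (\<phi> (act I \<pi> y)) (\<phi> (act I \<pi> (mix U y y')))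
            (\<phi> (act I \<pi> (mix U y' y))) (\<phi> (act I \<pi> y'))) \<le> 2 * d"
proof -
  have "\<forall>c\<in>I. \<exists>p. p \<in> Perm {..<s} \<and> p 0 = y c \<and> p 1 = y' c"
    using exists_perm_two_values y by blast
  from bchoice [OF this] obtain p where p: "\<And>c. c \<in> I \<Longrightarrow> p c \<in> Perm {..<s}"
    "\<And>c. c \<in> I \<Longrightarrow> p c 0 = y c" "\<And>c. c \<in> I \<Longrightarrow> p c 1 = y' c"
    by blast
  define A where "A = (\<lambda>c\<in>I. p c)"
  define B where "B = (\<lambda>c\<in>I. if c \<in> U then p c else p c \<circ> transpose 0 1)"
  have t: "transpose 0 1 permutes {..<s}" using s3 by (intro permutes_swap_id) auto
  have A: "A \<in> Shuffles" unfolding A_def Shuffles_def using p by auto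
  have B: "B \<in> Shuffles"
    unfolding B_def Shuffles_def using p permutes_compose [OF t] by (auto simp: Perm_def)
  have rows: "act I \<pi> (act I A (\<lambda>c. 0)) = act I \<pi> y" "act I \<pi> (act I A (\<lambda>c. 1)) = act I \<pi> y'"
    "act I \<pi> (act I B (\<lambda>c. 0)) = act I \<pi> (mix U y y')" "act I \<pi> (act I B (\<lambda>c. 1)) = act I \<pi> (mix U y' y)"
    for \<pi>
    using p by (auto intro!: act_cong simp: act_def A_def B_def mix_def simp del: One_nat_def)
  have same: "act I B (\<lambda>c. i) = act I A (\<lambda>c. i)" if "2 \<le> i" for i
    using that unfolding act_def A_def B_def by (auto simp: transpose_def)
  \<comment> \<open>Shuffles \<open>A\<close> and \<open>B\<close> agree on the constant words from \<open>2\<close> on.\<close>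
  have s2: "2 \<le> s" using s3 by simp
  have "balanced (\<phi> (act I \<pi> y)) (\<phi> (act I \<pi> (mix U y y'))) (\<phi> (act I \<pi> (mix U y' y))) (\<phi> (act I \<pi> y'))"
    if *: "(\<Sum>i<s. of_bool (\<phi> (act I \<pi> (act I A (\<lambda>c. i))))) = (1::nat)"
          "(\<Sum>i<s. of_bool (\<phi> (act I \<pi> (act I B (\<lambda>c. i))))) = (1::nat)" for \<pi>
  proof (rule balanced_exchange)
    have rest: "(\<Sum>i\<in>{2..<s}. of_bool (\<phi> (act I \<pi> (act I B (\<lambda>c. i)))))
        = (\<Sum>i\<in>{2..<s}. of_bool (\<phi> (act I \<pi> (act I A (\<lambda>c. i)))) :: nat)"
      by (rule sum.cong) (simp_all add: same)
    show "of_bool (\<phi> (act I \<pi> y)) + of_bool (\<phi> (act I \<pi> y'))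
        + (\<Sum>i\<in>{2..<s}. of_bool (\<phi> (act I \<pi> (act I A (\<lambda>c. i))))) = (1::nat)"
      using *(1) unfolding sum_split_two [OF s2] rows .
    show "of_bool (\<phi> (act I \<pi> (mix U y y'))) + of_bool (\<phi> (act I \<pi> (mix U y' y)))
        + (\<Sum>i\<in>{2..<s}. of_bool (\<phi> (act I \<pi> (act I A (\<lambda>c. i))))) = (1::nat)"
      using *(2) unfolding sum_split_two [OF s2] rows rest .
  qed
  then have "freq Shuffles (\<lambda>\<pi>. \<not> balanced (\<phi> (act I \<pi> y)) (\<phi> (act I \<pi> (mix U y y')))
            (\<phi> (act I \<pi> (mix U y' y))) (\<phi> (act I \<pi> y')))
     \<le> freq Shuffles (\<lambda>\<pi>. (\<Sum>i<s. of_bool (\<phi> (act I \<pi> (act I A (\<lambda>c. i))))) \<noteq> (1::nat))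
       + freq Shuffles (\<lambda>\<pi>. (\<Sum>i<s. of_bool (\<phi> (act I \<pi> (act I B (\<lambda>c. i))))) \<noteq> (1::nat))"
    by (intro freq_le2) blast
  with once_shuffled [OF A] once_shuffled [OF B] show ?thesis by linarith
qed

text \<open>
  The four words need not differ anywhere. With at least three colours there is a word \<open>w\<close> that differs
  everywhere from \<open>y\<close> and \<open>y'\<close> on \<open>U\<close>, and from \<open>z\<close> and \<open>z'\<close> off \<open>U\<close>. Comparing each of the four
  mixtures with \<open>w\<close> determines the shape of the table.
\<close>

lemma words_flat:
  assumes "y \<in> Words" "y' \<in> Words" "z \<in> Words" "z' \<in> Words"
  shows "freq Shuffles (\<lambda>\<pi>. \<not> flat (\<phi> (act I \<pi> (mix U y z))) (\<phi> (act I \<pi> (mix U y z')))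
            (\<phi> (act I \<pi> (mix U y' z))) (\<phi> (act I \<pi> (mix U y' z')))) \<le> 8 * d"
proof -
  have lt: "\<forall>c\<in>I. y c < s \<and> y' c < s \<and> z c < s \<and> z' c < s"
    using assms by (auto simp: Words_def PiE_iff)
  have "\<exists>v<s. v \<noteq> a \<and> v \<noteq> b" for a b
  proof -
    have "card {a, b} < card {..<s}" using s3 card_insert_le_m1 [of 2 "{b}" a] by simp
    then have "\<not> {..<s} \<subseteq> {a, b}" using card_mono [of "{a, b}" "{..<s}"] by auto
    then show ?thesis by auto
  qed
  then obtain f where f: "\<And>a b. f a b < s" "\<And>a b. f a b \<noteq> a" "\<And>a b. f a b \<noteq> b" by metis
  define w where "w c = (if c \<in> U then f (y c) (y' c) else f (z c) (z' c))" for c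
  define bal where "bal u v \<pi> \<longleftrightarrow> balanced (\<phi> (act I \<pi> (mix U u v))) (\<phi> (act I \<pi> (mix U u w)))
    (\<phi> (act I \<pi> (mix U w v))) (\<phi> (act I \<pi> w))" for u v \<pi>
  have bal: "freq Shuffles (\<lambda>\<pi>. \<not> bal u v \<pi>) \<le> 2 * d" if "u = y \<or> u = y'" "v = z \<or> v = z'" for u v
  proof -
    have "mix U (mix U u v) w = mix U u w" "mix U w (mix U u v) = mix U w v"
      by (auto simp: mix_def)
    moreover have "freq Shuffles (\<lambda>\<pi>. \<not> balanced (\<phi> (act I \<pi> (mix U u v))) (\<phi> (act I \<pi> (mix U (mix U u v) w)))
            (\<phi> (act I \<pi> (mix U w (mix U u v)))) (\<phi> (act I \<pi> w))) \<le> 2 * d"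
    proof (rule words_balanced)
      fix c assume c: "c \<in> I"
      show "mix U u v c < s" using c lt that by (auto simp: mix_def)
      show "w c < s" using f by (simp add: w_def)
      show "mix U u v c \<noteq> w c" using that f by (auto simp: mix_def w_def) metis+
    qed
    ultimately show ?thesis by (simp add: bal_def)
  qed
  have "freq Shuffles (\<lambda>\<pi>. \<not> flat (\<phi> (act I \<pi> (mix U y z))) (\<phi> (act I \<pi> (mix U y z')))
            (\<phi> (act I \<pi> (mix U y' z))) (\<phi> (act I \<pi> (mix U y' z'))))
     \<le> freq Shuffles (\<lambda>\<pi>. \<not> bal y z \<pi> \<or> \<not> bal y z' \<pi>) + freq Shuffles (\<lambda>\<pi>. \<not> bal y' z \<pi> \<or> \<not> bal y' z' \<pi>)"
    by (rule freq_le2) (auto simp: bal_def dest: flat_from_balanced)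
  also have "\<dots> \<le> (2 * d + 2 * d) + (2 * d + 2 * d)"
    by (intro add_mono order_trans [OF freq_disj] bal) auto
  finally show ?thesis by simp
qed

lemma words_flat_average:
  "freq (Words \<times> Words \<times> Words \<times> Words) (\<lambda>(y, y', z, z').
      \<not> flat (\<phi> (mix U y z)) (\<phi> (mix U y z')) (\<phi> (mix U y' z)) (\<phi> (mix U y' z'))) \<le> 8 * d"
proof -
  let ?Q = "Words \<times> Words \<times> Words \<times> Words"
  define F where "F = (\<lambda>(y, y', z, z').
     of_bool (\<not> flat (\<phi> (mix U y z)) (\<phi> (mix U y z')) (\<phi> (mix U y' z)) (\<phi> (mix U y' z'))) :: real)"
  define actq where "actq \<pi> = map_prod (act I \<pi>) (map_prod (act I \<pi>) (map_prod (act I \<pi>) (act I \<pi>)))" for \<pi>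
  have bij: "bij_betw (actq \<pi>) ?Q ?Q" if "\<pi> \<in> Shuffles" for \<pi>
    unfolding actq_def by (intro bij_betw_map_prod bij_betw_act that)
  have "avg ?Q F = avg Shuffles (\<lambda>\<pi>. avg ?Q F)"
    by (rule avg_const [OF Shuffles_fin_ne, symmetric])
  also have "\<dots> = avg Shuffles (\<lambda>\<pi>. avg ?Q (\<lambda>q. F (actq \<pi> q)))"
    by (rule avg_cong) (rule avg_reindex [OF bij])
  also have "\<dots> = avg ?Q (\<lambda>q. avg Shuffles (\<lambda>\<pi>. F (actq \<pi> q)))"
    by (rule avg_swap)
  also have "\<dots> \<le> 8 * d"
  proof (rule avg_bound)
    fix q assume q: "q \<in> ?Q"
    then obtain y y' z z' where eq: "q = (y, y', z, z')" "y \<in> Words" "y' \<in> Words" "z \<in> Words" "z' \<in> Words"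
      by auto
    show "avg Shuffles (\<lambda>\<pi>. F (actq \<pi> q)) \<le> 8 * d"
      using words_flat [OF eq(2-), of U] unfolding eq(1) F_def actq_def freq_def by (simp add: act_mix)
  qed (use Words_fin_ne in auto)
  finally show ?thesis unfolding freq_def F_def by (simp add: case_prod_unfold)
qed

text \<open>
  The probability that resampling all positions outside \<open>U\<close> changes the acceptance of a random word.
\<close>

definition sensitivity :: "nat set \<Rightarrow> real" where
  "sensitivity U = freq (Words \<times> Words) (\<lambda>(y, z). \<phi> y \<noteq> \<phi> (mix U y z))"

lemma sensitivity_three:
  "freq (Words \<times> Words \<times> Words) (\<lambda>(y, z, z'). \<phi> (mix U y z) \<noteq> \<phi> (mix U y z')) = sensitivity U"
proof -
  define f where "f y z = avg Words (\<lambda>z'. of_bool (\<phi> y \<noteq> \<phi> (mix U y z')))" for y and z :: "nat \<Rightarrow> nat"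
  have mm: "mix U (mix U y z) z' = mix U y z'" for y z z' by (auto simp: mix_def)
  have "freq (Words \<times> Words \<times> Words) (\<lambda>(y, z, z'). \<phi> (mix U y z) \<noteq> \<phi> (mix U y z'))
      = avg (Words \<times> Words) (\<lambda>(y, z). f (mix U y z) (mix U z y))"
    by (simp add: freq_def avg_Times f_def mm)
  also have "\<dots> = avg (Words \<times> Words) (\<lambda>(y, z). f y z)" by (rule avg_mix)
  also have "\<dots> = sensitivity U"
    by (simp add: sensitivity_def freq_def avg_Times f_def avg_const [OF Words_fin_ne])
  finally show ?thesis .
qed

text \<open>
  The product is the probability of two independent events: changing the \<open>U\<close>-part from \<open>y\<close> to \<open>y'\<close>
  matters next to \<open>x\<close>, and changing the other part from \<open>z\<close> to \<open>z'\<close> matters next to \<open>u\<close>. In the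
  3-by-3 table with rows \<open>y\<close>, \<open>y'\<close>, \<open>u\<close> and columns \<open>x\<close>, \<open>z\<close>, \<open>z'\<close>, flatness of three
  2-by-2 tables excludes that both happen.
\<close>

lemma sensitivity_product: "sensitivity U * sensitivity (- U) \<le> 24 * d"
proof -
  let ?W = Words
  define A where "A y y' z \<longleftrightarrow> \<phi> (mix U y z) \<noteq> \<phi> (mix U y' z)" for y y' z
  define B where "B u z z' \<longleftrightarrow> \<phi> (mix U u z) \<noteq> \<phi> (mix U u z')" for u z z'
  define F where "F y y' z z' \<longleftrightarrow> flat (\<phi> (mix U y z)) (\<phi> (mix U y z')) (\<phi> (mix U y' z)) (\<phi> (mix U y' z'))"
    for y y' z z'
  have swap: "mix (- U) y z = mix U z y" for y z by (auto simp: mix_def)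
  note const = avg_const [OF Words_fin_ne]
  have F: "freq (?W \<times> ?W \<times> ?W \<times> ?W) (\<lambda>(y, y', z, z'). \<not> F y y' z z') \<le> 8 * d"
    using words_flat_average unfolding F_def .
  have "freq (?W \<times> ?W \<times> ?W) (\<lambda>(z, y, y'). A y y' z) = sensitivity (- U)"
    using sensitivity_three [of "- U"] unfolding A_def swap .
  moreover have "freq (?W \<times> ?W \<times> ?W) (\<lambda>(y, y', z). A y y' z) = freq (?W \<times> ?W \<times> ?W) (\<lambda>(z, y, y'). A y y' z)"
    unfolding freq_def avg_Times prod.case by (rule avg_rotate)
  moreover have "freq (?W \<times> ?W \<times> ?W) (\<lambda>(u, z, z'). B u z z') = sensitivity U"
    using sensitivity_three [of U] unfolding B_def .
  moreover have "freq (?W \<times> ?W \<times> ?W) (\<lambda>(y, y', z). A y y' z) * freq (?W \<times> ?W \<times> ?W) (\<lambda>(u, z, z'). B u z z')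
      = freq (?W \<times> ?W \<times> ?W \<times> ?W \<times> ?W \<times> ?W) (\<lambda>(y, y', x, u, z, z'). A y y' x \<and> B u z z')"
    unfolding freq_def avg_Times by (simp add: of_bool_conj avg_cmult avg_multc)
  moreover have "freq (?W \<times> ?W \<times> ?W \<times> ?W \<times> ?W \<times> ?W) (\<lambda>(y, y', x, u, z, z'). A y y' x \<and> B u z z')
     \<le> freq (?W \<times> ?W \<times> ?W \<times> ?W \<times> ?W \<times> ?W) (\<lambda>(y, y', x, u, z, z'). \<not> F y y' x z)
       + freq (?W \<times> ?W \<times> ?W \<times> ?W \<times> ?W \<times> ?W) (\<lambda>(y, y', x, u, z, z'). \<not> F y y' x z')
       + freq (?W \<times> ?W \<times> ?W \<times> ?W \<times> ?W \<times> ?W) (\<lambda>(y, y', x, u, z, z'). \<not> F y u z z')"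
    by (rule freq_le3) (auto simp: A_def B_def F_def flat_def)
  moreover have "freq (?W \<times> ?W \<times> ?W \<times> ?W \<times> ?W \<times> ?W) (\<lambda>(y, y', x, u, z, z'). \<not> F y y' x z)
     = freq (?W \<times> ?W \<times> ?W \<times> ?W) (\<lambda>(y, y', z, z'). \<not> F y y' z z')"
    unfolding freq_def avg_Times by (simp add: const)
  moreover have "freq (?W \<times> ?W \<times> ?W \<times> ?W \<times> ?W \<times> ?W) (\<lambda>(y, y', x, u, z, z'). \<not> F y y' x z')
     = freq (?W \<times> ?W \<times> ?W \<times> ?W) (\<lambda>(y, y', z, z'). \<not> F y y' z z')"
    unfolding freq_def avg_Times by (simp add: const)
  moreover have "freq (?W \<times> ?W \<times> ?W \<times> ?W \<times> ?W \<times> ?W) (\<lambda>(y, y', x, u, z, z'). \<not> F y u z z')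
     = freq (?W \<times> ?W \<times> ?W \<times> ?W) (\<lambda>(y, y', z, z'). \<not> F y y' z z')"
    unfolding freq_def avg_Times by (simp add: const)
  ultimately show ?thesis using F by (simp add: mult.commute)
qed

text \<open>
  Take a proper subset \<open>U\<close> of \<open>I\<close>, maximal among those whose resampling hardly matters, and a position
  \<open>c\<close> outside. If \<open>insert c U\<close> is not all of \<open>I\<close>, its resampling matters, so by \<open>sensitivity_product\<close> the
  resampling of its complement hardly matters; if it is all of \<open>I\<close>, the complement is empty. Together, all positions except \<open>c\<close> can be resampled.
\<close>

lemma dictator:
  assumes "I \<noteq> {}"
  obtains c \<beta> where "c \<in> I" "freq Words (\<lambda>y. \<phi> y \<noteq> \<beta> (y c)) \<le> 2 * sqrt (24 * d)"
proof -
  define \<eta> where "\<eta> = sqrt (24 * d)"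
  have "0 \<le> d" using order_trans [OF freq_nonneg once] .
  then have \<eta>: "0 \<le> \<eta>" "\<eta> * \<eta> = 24 * d" unfolding \<eta>_def by auto
  have either: "sensitivity U \<le> \<eta> \<or> sensitivity (- U) \<le> \<eta>" for U
  proof (rule ccontr)
    assume "\<not> ?thesis"
    then have "\<eta> * \<eta> < sensitivity U * sensitivity (- U)"
      using \<eta>(1) by (intro mult_strict_mono') auto
    with sensitivity_product [of U] \<eta>(2) show False by simp
  qed
  have all: "sensitivity (- {}) \<le> \<eta>" "sensitivity I \<le> \<eta>"
  proof -
    have "mix (- {}) y z = y" for y z by (auto simp: mix_def)
    then show "sensitivity (- {}) \<le> \<eta>" unfolding sensitivity_def freq_def avg_def using \<eta>(1) by (simp add: case_prod_unfold)
    have "mix I y z = y" if "y \<in> Words" "z \<in> Words" for y z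
      using that by (auto simp: mix_def Words_def PiE_iff extensional_def)
    then have "sensitivity I = avg (Words \<times> Words) (\<lambda>_. 0)"
      unfolding sensitivity_def freq_def by (intro avg_cong) auto
    then show "sensitivity I \<le> \<eta>" using \<eta>(1) by (simp add: avg_def)
  qed
  define \<U> where "\<U> = {U. U \<subset> I \<and> sensitivity (- U) \<le> \<eta>}"
  have "finite \<U>"
    unfolding \<U>_def by (rule finite_subset [of _ "Pow I"]) (use finI in auto)
  moreover have "\<U> \<noteq> {}" using all(1) assms unfolding \<U>_def by blast
  ultimately have "\<exists>U\<in>\<U>. \<forall>V\<in>\<U>. U \<subseteq> V \<longrightarrow> U = V" by (rule finite_has_maximal)
  then obtain U where "U \<in> \<U>" and max: "\<And>V. V \<in> \<U> \<Longrightarrow> U \<subseteq> V \<Longrightarrow> U = V" by blast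
  then have U: "U \<subset> I" "sensitivity (- U) \<le> \<eta>" unfolding \<U>_def by auto
  from U(1) obtain c where c: "c \<in> I" "c \<notin> U" by blast
  let ?W = "insert c U"
  have W: "sensitivity ?W \<le> \<eta>"
  proof (cases "?W = I")
    case True
    then show ?thesis using all(2) by simp
  next
    case False
    then have "?W \<notin> \<U>" using max [of ?W] c by blast
    then have "\<not> sensitivity (- ?W) \<le> \<eta>" using U(1) c False unfolding \<U>_def by blast
    then show ?thesis using either [of ?W] by auto
  qed
  have "freq (Words \<times> Words) (\<lambda>(y, z). \<phi> y \<noteq> \<phi> (mix {c} y z))
    \<le> freq (Words \<times> Words) (\<lambda>(y, z). \<phi> y \<noteq> \<phi> (mix U z y))
      + freq (Words \<times> Words) (\<lambda>(y, z). \<phi> (mix U z y) \<noteq> \<phi> (mix {c} y z))"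
    by (rule freq_le2) auto
  also have "freq (Words \<times> Words) (\<lambda>(y, z). \<phi> y \<noteq> \<phi> (mix U z y)) = sensitivity (- U)"
  proof -
    have "mix (- U) y z = mix U z y" for y z by (auto simp: mix_def)
    then show ?thesis by (simp add: sensitivity_def)
  qed
  also have "freq (Words \<times> Words) (\<lambda>(y, z). \<phi> (mix U z y) \<noteq> \<phi> (mix {c} y z)) = sensitivity ?W"
  proof -
    have *: "mix (- U) y z = mix U z y" "mix {c} y z = mix ?W (mix U z y) (mix (- U) z y)" for y z
      using c by (auto simp: mix_def)
    have "freq (Words \<times> Words) (\<lambda>(y, z). \<phi> (mix U z y) \<noteq> \<phi> (mix {c} y z))
      = avg (Words \<times> Words) (\<lambda>(y, z). of_bool (\<phi> (mix (- U) y z) \<noteq> \<phi> (mix ?W (mix (- U) y z) (mix (- U) z y))))"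
      unfolding freq_def *(2) *(1) [symmetric] by (simp add: case_prod_unfold)
    also have "\<dots> = avg (Words \<times> Words) (\<lambda>(y, z). of_bool (\<phi> y \<noteq> \<phi> (mix ?W y z)))"
      by (rule avg_mix [of "\<lambda>y z. of_bool (\<phi> y \<noteq> \<phi> (mix ?W y z))"])
    also have "\<dots> = sensitivity ?W" by (simp add: sensitivity_def freq_def case_prod_unfold)
    finally show ?thesis .
  qed
  finally have "freq (Words \<times> Words) (\<lambda>(y, z). \<phi> y \<noteq> \<phi> (mix {c} y z)) \<le> 2 * \<eta>"
    using U(2) W by simp
  also have "freq (Words \<times> Words) (\<lambda>(y, z). \<phi> y \<noteq> \<phi> (mix {c} y z))
      = avg Words (\<lambda>z. freq Words (\<lambda>y. \<phi> y \<noteq> \<phi> (mix {c} y z)))"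
    unfolding freq_def avg_Times prod.case by (rule avg_swap)
  finally have "avg Words (\<lambda>z. freq Words (\<lambda>y. \<phi> y \<noteq> \<phi> (mix {c} y z))) \<le> 2 * \<eta>" .
  moreover obtain z where "freq Words (\<lambda>y. \<phi> y \<noteq> \<phi> (mix {c} y z))
      \<le> avg Words (\<lambda>z. freq Words (\<lambda>y. \<phi> y \<noteq> \<phi> (mix {c} y z)))"
    using avg_exists_le [OF Words_fin_ne, of "\<lambda>z. freq Words (\<lambda>y. \<phi> y \<noteq> \<phi> (mix {c} y z))"] by blast
  ultimately have "freq Words (\<lambda>y. \<phi> y \<noteq> \<phi> (mix {c} y z)) \<le> 2 * \<eta>" by linarith
  moreover have "mix {c} y z = z(c := y c)" for y by (auto simp: mix_def)
  ultimately show thesis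
    using that [of c "\<lambda>a. \<phi> (z(c := a))"] c by (simp add: \<eta>_def)
qed

end

section \<open>Class sizes and symmetries of random colourings\<close>

context colour_words
begin

lemma avg_Shuffles_word:
  assumes "w \<in> Words"
  shows "avg Shuffles (\<lambda>\<pi>. f (act I \<pi> w)) = avg Words f"
proof -
  have same: "avg Shuffles (\<lambda>\<pi>. f (act I \<pi> w)) = avg Shuffles (\<lambda>\<pi>. f (act I \<pi> w'))" if "w' \<in> Words" for w'
  proof -
    define \<pi>\<^sub>0 where "\<pi>\<^sub>0 = (\<lambda>c\<in>I. transpose (w c) (w' c))"
    have lt: "w c \<in> {..<s}" "w' c \<in> {..<s}" if "c \<in> I" for c
      using assms \<open>w' \<in> Words\<close> that unfolding Words_def by auto
    have "\<pi>\<^sub>0 \<in> Shuffles"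
      unfolding \<pi>\<^sub>0_def Shuffles_def Perm_def using permutes_swap_id [OF lt] by auto
    moreover have "act I (\<lambda>c\<in>I. \<pi> c \<circ> \<pi>\<^sub>0 c) w = act I \<pi> w'" for \<pi>
      unfolding act_def \<pi>\<^sub>0_def by auto
    ultimately show ?thesis using avg_Shuffles_right [of \<pi>\<^sub>0 "\<lambda>\<pi>. f (act I \<pi> w)"] by simp
  qed
  have "avg Shuffles (\<lambda>\<pi>. f (act I \<pi> w)) = avg Words (\<lambda>w'. avg Shuffles (\<lambda>\<pi>. f (act I \<pi> w)))"
    by (rule avg_const [OF Words_fin_ne, symmetric])
  also have "\<dots> = avg Words (\<lambda>w'. avg Shuffles (\<lambda>\<pi>. f (act I \<pi> w')))"
    by (rule avg_cong) (rule same)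
  also have "\<dots> = avg Shuffles (\<lambda>\<pi>. avg Words (\<lambda>w'. f (act I \<pi> w')))"
    by (rule avg_swap)
  also have "\<dots> = avg Shuffles (\<lambda>\<pi>. avg Words f)"
    by (rule avg_cong) (rule avg_reindex [OF bij_betw_act, symmetric])
  also have "\<dots> = avg Words f" by (rule avg_const [OF Shuffles_fin_ne])
  finally show ?thesis .
qed

lemma freq_Words_zero:
  assumes "J \<subseteq> I"
  shows "freq Words (\<lambda>\<chi>. \<forall>c\<in>J. \<chi> c = 0) = (1 / real s) ^ card J"
proof -
  have fJ: "finite J" using assms finI finite_subset by blast
  have "{\<chi> \<in> Words. \<forall>c\<in>J. \<chi> c = 0} = PiE I (\<lambda>c. if c \<in> J then {0} else {..<s})"
    using assms s3 unfolding Words_def by (auto simp: PiE_iff extensional_def split: if_splits)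
  then have "card {\<chi> \<in> Words. \<forall>c\<in>J. \<chi> c = 0} = (\<Prod>c\<in>I. if c \<in> J then 1 else s)"
    using finI by (simp add: card_PiE if_distrib cong: if_cong)
  also have "\<dots> = s ^ card (I - J)"
    using finI by (simp add: prod.If_cases Diff_eq Compl_eq)
  finally have "card {\<chi> \<in> Words. \<forall>c\<in>J. \<chi> c = 0} = s ^ card (I - J)" .
  moreover have "card Words = s ^ card (I - J) * s ^ card J"
    using finI assms fJ card_mono [OF finI assms]
    by (simp add: Words_def card_PiE card_Diff_subset flip: power_add)
  ultimately show ?thesis using s3 by (simp add: freq_card power_one_over)
qed

definition zeros :: "(nat \<Rightarrow> nat) \<Rightarrow> nat set" where
  "zeros \<chi> = {c \<in> I. \<chi> c = 0}"

lemma zeros_subset: "zeros \<chi> \<subseteq> I"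
  unfolding zeros_def by auto

lemma avg_card_zeros:
  "avg Words (\<lambda>\<chi>. real (card (zeros \<chi>))) = real (card I) / real s"
  "avg Words (\<lambda>\<chi>. (real (card (zeros \<chi>)))\<^sup>2)
     = real (card I) / real s + real (card I) * (real (card I) - 1) / (real s)\<^sup>2"
proof -
  have card: "real (card (zeros \<chi>)) = (\<Sum>c\<in>I. of_bool (\<forall>j\<in>{c}. \<chi> j = 0))" for \<chi>
    using finI by (simp add: zeros_def Int_def)
  have one: "freq Words (\<lambda>\<chi>. \<forall>j\<in>{c}. \<chi> j = 0) = 1 / real s" if "c \<in> I" for c
    using freq_Words_zero [of "{c}"] that by simp
  show "avg Words (\<lambda>\<chi>. real (card (zeros \<chi>))) = real (card I) / real s"
    unfolding card avg_sum using one by (simp add: freq_def)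
  have sq: "(real (card (zeros \<chi>)))\<^sup>2 = (\<Sum>c\<in>I. \<Sum>c'\<in>I. of_bool (\<forall>j\<in>{c, c'}. \<chi> j = 0))" for \<chi>
    unfolding card power2_eq_square sum_product by (intro sum.cong) auto
  have two: "freq Words (\<lambda>\<chi>. \<forall>j\<in>{c, c'}. \<chi> j = 0) = (if c' = c then 1 / real s else 1 / (real s)\<^sup>2)"
    if "c \<in> I" "c' \<in> I" for c c'
    using freq_Words_zero [of "{c, c'}"] that by (auto simp: power_one_over power2_eq_square)
  have "avg Words (\<lambda>\<chi>. (real (card (zeros \<chi>)))\<^sup>2)
      = (\<Sum>c\<in>I. \<Sum>c'\<in>I. if c' = c then 1 / real s else 1 / (real s)\<^sup>2)"
    unfolding sq avg_sum using two by (intro sum.cong) (auto simp: freq_def)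
  also have "\<dots> = (\<Sum>c\<in>I. 1 / real s + (real (card I) - 1) / (real s)\<^sup>2)"
  proof (rule sum.cong)
    fix c assume c: "c \<in> I"
    then have "(\<Sum>c'\<in>I. if c' = c then 1 / real s else 1 / (real s)\<^sup>2)
      = 1 / real s + (\<Sum>c'\<in>I - {c}. 1 / (real s)\<^sup>2)"
      using finI by (subst sum.remove [of I c]) (auto intro!: sum.cong)
    moreover have "real (card (I - {c})) = real (card I) - 1"
      using c finI card_gt_0_iff [of I] by (subst card_Diff_singleton) (auto simp: of_nat_diff)
    ultimately show "(\<Sum>c'\<in>I. if c' = c then 1 / real s else 1 / (real s)\<^sup>2)
      = 1 / real s + (real (card I) - 1) / (real s)\<^sup>2" by simp
  qed simp
  finally show "avg Words (\<lambda>\<chi>. (real (card (zeros \<chi>)))\<^sup>2)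
     = real (card I) / real s + real (card I) * (real (card I) - 1) / (real s)\<^sup>2"
    by (simp add: distrib_left)
qed

text \<open>
  The class of colour \<open>0\<close> stands for a random \<open>k\<close>-set, so its distribution has to be invariant under
  permutations of the ground set.
\<close>

lemma avg_zeros_image:
  assumes "\<tau> \<in> Perm I"
  shows "avg Words (\<lambda>\<chi>. f (\<tau> ` zeros \<chi>)) = avg Words (\<lambda>\<chi>. f (zeros \<chi>))"
proof -
  have p: "\<tau> permutes I" using assms by (simp add: Perm_def)
  have q: "inv \<tau> permutes I" by (rule permutes_inv [OF p])
  have bij: "bij_betw (\<lambda>\<chi>. \<lambda>c\<in>I. \<chi> (inv \<tau> c)) Words Words"
  proof (rule bij_betwI [where g = "\<lambda>\<chi>. \<lambda>c\<in>I. \<chi> (\<tau> c)"])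
    show "(\<lambda>\<chi>. \<lambda>c\<in>I. \<chi> (inv \<tau> c)) \<in> Words \<rightarrow> Words" "(\<lambda>\<chi>. \<lambda>c\<in>I. \<chi> (\<tau> c)) \<in> Words \<rightarrow> Words"
      using permutes_in_image [OF p] permutes_in_image [OF q] by (auto simp: Words_def PiE_iff)
    fix \<chi> assume "\<chi> \<in> Words"
    then have ext: "\<chi> c = undefined" if "c \<notin> I" for c
      using that by (auto simp: Words_def PiE_iff extensional_def)
    show "(\<lambda>c\<in>I. (\<lambda>c\<in>I. \<chi> (inv \<tau> c)) (\<tau> c)) = \<chi>" "(\<lambda>c\<in>I. (\<lambda>c\<in>I. \<chi> (\<tau> c)) (inv \<tau> c)) = \<chi>"
      using ext permutes_in_image [OF p] permutes_in_image [OF q] permutes_inverses [OF p]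
      by (auto simp: fun_eq_iff)
  qed
  have "zeros (\<lambda>c\<in>I. \<chi> (inv \<tau> c)) = \<tau> ` zeros \<chi>" for \<chi>
  proof
    show "zeros (\<lambda>c\<in>I. \<chi> (inv \<tau> c)) \<subseteq> \<tau> ` zeros \<chi>"
    proof
      fix c assume "c \<in> zeros (\<lambda>c\<in>I. \<chi> (inv \<tau> c))"
      then have "inv \<tau> c \<in> zeros \<chi>" using permutes_in_image [OF q] by (auto simp: zeros_def)
      then have "\<tau> (inv \<tau> c) \<in> \<tau> ` zeros \<chi>" by (rule imageI)
      then show "c \<in> \<tau> ` zeros \<chi>" using permutes_inverses [OF p] by simp
    qed
    show "\<tau> ` zeros \<chi> \<subseteq> zeros (\<lambda>c\<in>I. \<chi> (inv \<tau> c))"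
      using permutes_in_image [OF p] permutes_inverses [OF p] by (auto simp: zeros_def)
  qed
  then show ?thesis using avg_reindex [OF bij, of "\<lambda>\<chi>. f (zeros \<chi>)"] by simp
qed

text \<open>
  An event that depends on the class of colour \<open>0\<close> only does not distinguish the nonzero colours, and
  colour \<open>1\<close> accounts for one of at most \<open>s\<close> equal parts.
\<close>

lemma freq_nonzero_colour:
  assumes c: "c \<in> I"
    and inv: "\<And>\<chi> \<chi>'. zeros \<chi> = zeros \<chi>' \<Longrightarrow> Q \<chi> = Q \<chi>'"
  shows "freq Words (\<lambda>\<chi>. c \<notin> zeros \<chi> \<and> Q \<chi>) \<le> real s * freq Words (\<lambda>\<chi>. \<chi> c = 1 \<and> Q \<chi>)"
proof -
  have "freq Words (\<lambda>\<chi>. c \<notin> zeros \<chi> \<and> Q \<chi>) \<le> (\<Sum>a\<in>{1..<s}. freq Words (\<lambda>\<chi>. \<chi> c = a \<and> Q \<chi>))"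
  proof (rule freq_Bex)
    fix \<chi> assume "\<chi> \<in> Words" "c \<notin> zeros \<chi> \<and> Q \<chi>"
    then show "\<exists>a\<in>{1..<s}. \<chi> c = a \<and> Q \<chi>" using c by (auto simp: Words_def zeros_def PiE_iff)
  qed simp
  also have "\<dots> = (\<Sum>a\<in>{1..<s}. freq Words (\<lambda>\<chi>. \<chi> c = 1 \<and> Q \<chi>))"
  proof (rule sum.cong)
    fix a assume a: "a \<in> {1..<s}"
    define \<pi> where "\<pi> = (\<lambda>j\<in>I. if j = c then transpose 1 a else id)"
    have "transpose 1 a permutes {..<s}" using a s3 by (intro permutes_swap_id) auto
    then have \<pi>: "\<pi> \<in> Shuffles"
      unfolding \<pi>_def Shuffles_def Perm_def by (auto simp: permutes_id)
    have z: "zeros (act I \<pi> \<chi>) = zeros \<chi>" for \<chi>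
      using a unfolding zeros_def act_def \<pi>_def by (auto simp: transpose_eq_iff)
    have "(act I \<pi> \<chi> c = a) = (\<chi> c = 1)" for \<chi>
      using c a unfolding act_def \<pi>_def by (auto simp: transpose_eq_iff)
    then show "freq Words (\<lambda>\<chi>. \<chi> c = a \<and> Q \<chi>) = freq Words (\<lambda>\<chi>. \<chi> c = 1 \<and> Q \<chi>)"
      unfolding freq_def using avg_reindex [OF bij_betw_act [OF \<pi>], of "\<lambda>\<chi>. of_bool (\<chi> c = a \<and> Q \<chi>)"]
        inv [OF z] by simp
  qed simp
  also have "\<dots> \<le> real s * freq Words (\<lambda>\<chi>. \<chi> c = 1 \<and> Q \<chi>)"
    by (simp add: freq_nonneg mult_right_mono)
  finally show ?thesis .
qed

end

section \<open>Replacing k-sets by colour classes\<close>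

lemma card_ksets: "finite E \<Longrightarrow> card (ksets E k) = card E choose k"
  unfolding ksets_def by (rule n_subsets)

lemma enlarge_to_ksets:
  fixes s :: nat
  assumes fin: "finite E" and E: "s * k \<le> card E"
    and Q: "\<And>i. i < s \<Longrightarrow> Q i \<subseteq> E" "\<And>i. i < s \<Longrightarrow> card (Q i) \<le> k" "disjoint_family_on Q {..<s}"
  obtains P where "\<And>i. i < s \<Longrightarrow> P i \<in> ksets E k" "\<And>i. i < s \<Longrightarrow> Q i \<subseteq> P i" "disjoint_family_on P {..<s}"
proof -
  have "\<exists>P. (\<forall>i<m. card (P i) = k) \<and> (\<forall>i<s. Q i \<subseteq> P i \<and> P i \<subseteq> E \<and> card (P i) \<le> k) \<and> disjoint_family_on P {..<s}"
    if "m \<le> s" for m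
    using that
  proof (induction m)
    case 0
    have "(\<forall>i<0. card (Q i) = k) \<and> (\<forall>i<s. Q i \<subseteq> Q i \<and> Q i \<subseteq> E \<and> card (Q i) \<le> k) \<and> disjoint_family_on Q {..<s}"
      using Q by simp
    then show ?case by blast
  next
    case (Suc m)
    then obtain P where P: "\<forall>i<m. card (P i) = k" "\<forall>i<s. Q i \<subseteq> P i \<and> P i \<subseteq> E \<and> card (P i) \<le> k"
      "disjoint_family_on P {..<s}" by auto
    have m: "m < s" using Suc.prems by simp
    define W where "W = (\<Union>i\<in>{..<s} - {m}. P i)"
    have WE: "W \<subseteq> E" unfolding W_def using P(2) by auto
    have "card W \<le> (\<Sum>i\<in>{..<s} - {m}. card (P i))" unfolding W_def by (rule card_UN_le) simp
    also have "\<dots> \<le> (\<Sum>i\<in>{..<s} - {m}. k)" using P(2) by (intro sum_mono) auto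
    also have "\<dots> = (s - 1) * k" using m by simp
    finally have "card W \<le> s * k - k" by (simp add: diff_mult_distrib)
    moreover have "k \<le> s * k" using m by (cases s) auto
    moreover have "card (E - W) = card E - card W"
      using WE fin finite_subset by (intro card_Diff_subset) auto
    ultimately have kW: "k \<le> card (E - W)" using E by linarith
    have "P m \<inter> W = {}"
      unfolding W_def using P(3) m by (auto simp: disjoint_family_on_def)
    then have sub: "P m \<subseteq> E - W" using P(2) m by auto
    obtain X where X: "P m \<subseteq> X" "X \<subseteq> E - W" "card X = k"
      using exists_subset_between [OF _ kW sub] P(2) m fin by auto
    have "\<forall>i<Suc m. card ((P(m := X)) i) = k" using P(1) X by (auto simp: less_Suc_eq)
    moreover have "\<forall>i<s. Q i \<subseteq> (P(m := X)) i \<and> (P(m := X)) i \<subseteq> E \<and> card ((P(m := X)) i) \<le> k"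
      using P(2) X by auto
    moreover have "disjoint_family_on (P(m := X)) {..<s}"
      unfolding disjoint_family_on_def
    proof (intro ballI impI)
      fix i j assume ij: "i \<in> {..<s}" "j \<in> {..<s}" "i \<noteq> j"
      have XP: "X \<inter> P l = {}" if "l \<in> {..<s}" "l \<noteq> m" for l
        using X(2) that unfolding W_def by auto
      have PP: "P i \<inter> P j = {}" using P(3) ij unfolding disjoint_family_on_def by blast
      show "(P(m := X)) i \<inter> (P(m := X)) j = {}"
        using XP [of i] XP [of j] PP ij by (cases "i = m"; cases "j = m") auto
    qed
    ultimately show ?case by blast
  qed
  from this [of s] obtain P where "\<forall>i<s. card (P i) = k" "\<forall>i<s. Q i \<subseteq> P i \<and> P i \<subseteq> E \<and> card (P i) \<le> k"
    "disjoint_family_on P {..<s}" by auto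
  then show thesis using that [of P] by (auto simp: ksets_def)
qed

lemma freq_Perm_mem:
  assumes fin: "finite E" and c: "c \<in> E" and S: "S \<subseteq> E"
  shows "freq (Perm E) (\<lambda>\<tau>. c \<in> \<tau> ` S) \<le> real (card S) / real (card E)"
proof -
  have one: "freq (Perm E) (\<lambda>\<tau>. \<tau> x = c) = 1 / real (card E)" if "x \<in> E" for x
  proof -
    have "freq (Perm E) (\<lambda>\<tau>. \<tau> x = c) = avg (Perm E) (\<lambda>\<tau>. of_bool (\<tau> ` {x} = {c}))"
      unfolding freq_def by simp
    also have "\<dots> = freq (ksets E 1) (\<lambda>B. B = {c})"
      unfolding freq_def by (rule avg_perm_image [OF fin]) (use that in \<open>simp add: ksets_def\<close>)
    also have "{B \<in> ksets E 1. B = {c}} = {{c}}" using c by (auto simp: ksets_def)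
    then have "freq (ksets E 1) (\<lambda>B. B = {c}) = 1 / real (card E)"
      using card_ksets [OF fin, of 1] by (simp add: freq_card)
    finally show ?thesis .
  qed
  have "finite S" using S fin finite_subset by blast
  then have "freq (Perm E) (\<lambda>\<tau>. c \<in> \<tau> ` S) \<le> (\<Sum>x\<in>S. freq (Perm E) (\<lambda>\<tau>. \<tau> x = c))"
    by (rule freq_Bex) auto
  also have "\<dots> = (\<Sum>x\<in>S. 1 / real (card E))"
    using one S by (intro sum.cong) auto
  finally show ?thesis by simp
qed

context hitting_family
begin

sublocale colour_words E s
  by unfold_locales (rule finE, rule s3)

text \<open>
  A \<open>k\<close>-set nearest to \<open>T\<close>. The choice is arbitrary but fixed; it need not commute with
  permutations, and \<open>adjust_commutes\<close> bounds the resulting error.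
\<close>

definition adjust :: "nat set \<Rightarrow> nat set" where
  "adjust T = (SOME A. A \<in> ksets E k \<and> (A \<subseteq> T \<or> T \<subseteq> A))"

definition gap :: "nat set \<Rightarrow> nat" where
  "gap T = (card T - k) + (k - card T)"

lemma k_le_card: "k \<le> card E"
  using cardE s3 by (cases s) auto

lemma adjust:
  assumes "T \<subseteq> E"
  shows "adjust T \<in> ksets E k" "k \<le> card T \<Longrightarrow> adjust T \<subseteq> T" "card T \<le> k \<Longrightarrow> T \<subseteq> adjust T"
proof -
  have fT: "finite T" using assms finE finite_subset by blast
  have "\<exists>A. A \<in> ksets E k \<and> (A \<subseteq> T \<or> T \<subseteq> A)"
  proof (cases "k \<le> card T")
    case True
    then obtain A where "A \<subseteq> T" "card A = k" using obtain_subset_with_card_n by blast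
    then show ?thesis using assms unfolding ksets_def by blast
  next
    case False
    then obtain A where "T \<subseteq> A" "A \<subseteq> E" "card A = k"
      using exists_subset_between [of T k E] assms finE k_le_card by auto
    then show ?thesis unfolding ksets_def by blast
  qed
  then have *: "adjust T \<in> ksets E k \<and> (adjust T \<subseteq> T \<or> T \<subseteq> adjust T)"
    unfolding adjust_def by (rule someI_ex)
  then show "adjust T \<in> ksets E k" by blast
  from * have fin: "finite (adjust T)" and card: "card (adjust T) = k"
    using finE finite_subset by (auto simp: ksets_def)
  show "adjust T \<subseteq> T" if "k \<le> card T"
    using * that card_seteq [OF fin, of T] card by auto
  show "T \<subseteq> adjust T" if "card T \<le> k"
    using * that card_seteq [OF fT, of "adjust T"] card by auto
qed

lemma card_between_diff:
  assumes T: "T \<subseteq> E" and A: "A \<in> ksets E k" "B \<in> ksets E k"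
    and AT: "k \<le> card T \<Longrightarrow> A \<subseteq> T \<and> B \<subseteq> T" "card T \<le> k \<Longrightarrow> T \<subseteq> A \<and> T \<subseteq> B"
  shows "card (A - B) \<le> gap T"
proof -
  have fin: "finite T" "finite A" "finite B" "card A = k" "card B = k"
    using T A finE finite_subset by (auto simp: ksets_def)
  show ?thesis
  proof (cases "k \<le> card T")
    case True
    then have "card (A - B) \<le> card (T - B)" using AT(1) fin by (intro card_mono) auto
    also have "\<dots> = card T - k" using AT(1) True fin by (simp add: card_Diff_subset)
    finally show ?thesis by (simp add: gap_def)
  next
    case False
    then have "card (A - B) \<le> card (A - T)" using AT(2) fin by (intro card_mono) auto
    also have "\<dots> = k - card T" using AT(2) False fin by (simp add: card_Diff_subset)
    finally show ?thesis by (simp add: gap_def)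
  qed
qed

text \<open>
  Large classes are cut down to \<open>k\<close> elements first; the elements that become free, and the additional
  element of \<open>E\<close>, suffice to fill up the small classes.
\<close>

lemma packing_near:
  assumes T: "\<And>i. i < s \<Longrightarrow> T i \<subseteq> E" "disjoint_family_on T {..<s}"
  obtains P where "\<And>i. i < s \<Longrightarrow> P i \<in> ksets E k" "disjoint_family_on P {..<s}"
    "\<And>i. i < s \<Longrightarrow> card (P i - adjust (T i)) \<le> gap (T i)"
proof -
  define Q where "Q i = (if k \<le> card (T i) then adjust (T i) else T i)" for i
  have QT: "Q i \<subseteq> T i" "card (Q i) \<le> k" if "i < s" for i
    using adjust [OF T(1) [OF that]] by (auto simp: Q_def ksets_def)
  have Q1: "Q i \<subseteq> E" if "i < s" for i using QT(1) [OF that] T(1) [OF that] by blast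
  have Q2: "disjoint_family_on Q {..<s}"
    using T(2) QT(1) unfolding disjoint_family_on_def by blast
  have "s * k \<le> card E" using cardE by simp
  then obtain P where P: "\<And>i. i < s \<Longrightarrow> P i \<in> ksets E k" "\<And>i. i < s \<Longrightarrow> Q i \<subseteq> P i"
    "disjoint_family_on P {..<s}"
    using enlarge_to_ksets [OF finE _ Q1 QT(2) Q2] by blast
  have "card (P i - adjust (T i)) \<le> gap (T i)" if i: "i < s" for i
  proof (cases "k \<le> card (T i)")
    case True
    have "card (adjust (T i)) = k" "card (P i) = k" "finite (P i)"
      using adjust(1) [OF T(1) [OF i]] P(1) [OF i] finE finite_subset by (auto simp: ksets_def)
    moreover have "adjust (T i) \<subseteq> P i" using P(2) [OF i] True by (simp add: Q_def)
    ultimately have "adjust (T i) = P i" by (simp add: card_subset_eq)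
    then show ?thesis by simp
  next
    case False
    then have "T i \<subseteq> P i" using P(2) [OF i] by (simp add: Q_def)
    then show ?thesis
      using False adjust [OF T(1) [OF i]] P(1) [OF i] T(1) [OF i] by (intro card_between_diff) auto
  qed
  with P that show thesis by blast
qed

text \<open>
  The bound of \<open>hits_stable\<close>, valid for a change of at most \<open>k / m\<close> elements.
\<close>

definition noise :: "nat \<Rightarrow> real" where
  "noise m = 1 / real m + 2 * real m * excess"

definition deviation :: "nat \<Rightarrow> real" where
  "deviation m = freq Words (\<lambda>\<chi>. k < m * gap (zeros \<chi>))"

lemma noise_nonneg: "0 \<le> noise m"
  unfolding noise_def using excess_nonneg by simp

lemma hits_close:
  assumes A: "A \<in> ksets E k" "A' \<in> ksets E k" and m: "1 \<le> m" and D: "card (A - A') \<le> D"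
  shows "pr (\<lambda>\<sigma>. hits \<sigma> A \<noteq> hits \<sigma> A') \<le> noise m + of_bool (k < m * D)"
proof (cases "k < m * D")
  case True
  have "pr (\<lambda>\<sigma>. hits \<sigma> A \<noteq> hits \<sigma> A') \<le> 1" by (rule freq_le_1)
  moreover have "of_bool (k < m * D) = (1::real)" using True by simp
  ultimately show ?thesis using noise_nonneg [of m] by linarith
next
  case False
  have "m * card (A - A') \<le> m * D" using D by simp
  then have "m * card (A - A') \<le> k" using False by linarith
  then show ?thesis using hits_stable [OF A m] False by (simp add: noise_def)
qed

text \<open>
  This is Chebyshev's inequality; the mean square distance of the size of a colour class from \<open>k\<close> is at
  most \<open>2 * k\<close>.
\<close>

lemma deviation_le:
  assumes "1 \<le> m"
  shows "deviation m \<le> 2 * (real m)\<^sup>2 / real k"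
proof -
  have k: "0 < real k" using k1 by simp
  have "of_bool (k < m * gap T) \<le> ((real m / real k)\<^sup>2 * (real (card T) - real k)\<^sup>2 :: real)" for T
  proof (cases "k < m * gap T")
    case True
    have "real (gap T) = \<bar>real (card T) - real k\<bar>" by (simp add: gap_def of_nat_diff)
    moreover have "real k < real (m * gap T)" using True by (simp only: of_nat_less_iff)
    ultimately have "real k \<le> real m * \<bar>real (card T) - real k\<bar>" by simp
    then have "1 \<le> real m / real k * \<bar>real (card T) - real k\<bar>" using k by (simp add: field_simps)
    then have "1 \<le> (real m / real k * \<bar>real (card T) - real k\<bar>)\<^sup>2" by (rule one_le_power)
    then have "1 \<le> (real m / real k)\<^sup>2 * (real (card T) - real k)\<^sup>2"
      by (simp only: power_mult_distrib power2_abs)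
    then show ?thesis using True by simp
  qed simp
  then have "deviation m \<le> avg Words (\<lambda>\<chi>. (real m / real k)\<^sup>2 * (real (card (zeros \<chi>)) - real k)\<^sup>2)"
    unfolding deviation_def freq_def by (intro avg_mono)
  also have "\<dots> = (real m / real k)\<^sup>2 * avg Words (\<lambda>\<chi>. (real (card (zeros \<chi>)) - real k)\<^sup>2)"
    by (rule avg_cmult)
  also have "avg Words (\<lambda>\<chi>. (real (card (zeros \<chi>)) - real k)\<^sup>2)
      = avg Words (\<lambda>\<chi>. (real (card (zeros \<chi>)))\<^sup>2 + ((- 2 * real k) * real (card (zeros \<chi>)) + (real k)\<^sup>2))"
    by (rule avg_cong) (simp add: power2_eq_square algebra_simps)
  also have "\<dots> = avg Words (\<lambda>\<chi>. (real (card (zeros \<chi>)))\<^sup>2)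
      + ((- 2 * real k) * avg Words (\<lambda>\<chi>. real (card (zeros \<chi>))) + (real k)\<^sup>2)"
    by (simp only: avg_add avg_cmult avg_const [OF Words_fin_ne])
  also have "\<dots> = real k + 1 / real s - real k / real s"
  proof -
    have "real (card E) = real s * real k + 1" using cardE by simp
    then show ?thesis
      unfolding avg_card_zeros using s3 by (simp add: field_simps power2_eq_square)
  qed
  also have "\<dots> \<le> 2 * real k"
  proof -
    have "1 / real s \<le> 1" using s3 by simp
    moreover have "0 \<le> real k / real s" by simp
    moreover have "1 \<le> real k" using k1 by simp
    ultimately show ?thesis by linarith
  qed
  finally have "deviation m \<le> (real m / real k)\<^sup>2 * (2 * real k)" by (simp add: mult_left_mono)
  also have "\<dots> = 2 * (real m)\<^sup>2 / real k" using k by (simp add: power2_eq_square)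
  finally show ?thesis .
qed

text \<open>
  The adjusted colour classes need not be disjoint, but each is within its size defect of a block of a true
  packing. The permutation \<open>\<sigma>\<close> is averaged as well, because stability holds only on average over \<open>\<sigma>\<close>.
\<close>

lemma colouring_exact:
  assumes m: "1 \<le> m"
  shows "avg (Perm E) (\<lambda>\<sigma>. freq Shuffles (\<lambda>\<pi>.
      (\<Sum>i<s. of_bool (hits \<sigma> (adjust (zeros (act E \<pi> (\<lambda>c. i)))))) \<noteq> (1::nat)))
    \<le> excess + real s * (noise m + deviation m)"
proof -
  let ?T = "\<lambda>\<pi> i. zeros (act E \<pi> (\<lambda>c. i))"
  have one: "pr (\<lambda>\<sigma>. (\<Sum>i<s. of_bool (hits \<sigma> (adjust (?T \<pi> i)))) \<noteq> (1::nat))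
      \<le> excess + (\<Sum>i<s. noise m + of_bool (k < m * gap (?T \<pi> i)))" if \<pi>: "\<pi> \<in> Shuffles" for \<pi>
  proof -
    have "disjoint_family_on (?T \<pi>) {..<s}"
      unfolding disjoint_family_on_def
    proof (intro ballI impI)
      fix i j :: nat assume "i \<noteq> j"
      have "inj (\<pi> c)" if "c \<in> E" for c
        using \<pi> that by (auto simp: Shuffles_def PiE_iff intro: Perm_inj)
      with \<open>i \<noteq> j\<close> show "?T \<pi> i \<inter> ?T \<pi> j = {}"
        unfolding zeros_def act_def by (auto simp: inj_def)
    qed
    then obtain P where P: "\<And>i. i < s \<Longrightarrow> P i \<in> ksets E k" "disjoint_family_on P {..<s}"
      "\<And>i. i < s \<Longrightarrow> card (P i - adjust (?T \<pi> i)) \<le> gap (?T \<pi> i)"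
      using packing_near [of "?T \<pi>"] zeros_subset by blast
    have same: "(\<Sum>i<s. of_bool (hits \<sigma> (P i))) = (\<Sum>i<s. of_bool (hits \<sigma> (adjust (?T \<pi> i))) :: nat)"
      if "\<not> (\<exists>i\<in>{..<s}. hits \<sigma> (P i) \<noteq> hits \<sigma> (adjust (?T \<pi> i)))" for \<sigma>
      by (rule sum.cong) (use that in auto)
    have "pr (\<lambda>\<sigma>. (\<Sum>i<s. of_bool (hits \<sigma> (adjust (?T \<pi> i)))) \<noteq> (1::nat))
       \<le> pr (\<lambda>\<sigma>. (\<Sum>i<s. of_bool (hits \<sigma> (P i))) \<noteq> (1::nat))
         + pr (\<lambda>\<sigma>. \<exists>i\<in>{..<s}. hits \<sigma> (P i) \<noteq> hits \<sigma> (adjust (?T \<pi> i)))"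
      by (rule freq_le2) (metis same)
    also have "\<dots> \<le> excess + (\<Sum>i<s. pr (\<lambda>\<sigma>. hits \<sigma> (P i) \<noteq> hits \<sigma> (adjust (?T \<pi> i))))"
      by (intro add_mono hits_once P freq_Bex) auto
    also have "\<dots> \<le> excess + (\<Sum>i<s. noise m + of_bool (k < m * gap (?T \<pi> i)))"
      using P adjust(1) [OF zeros_subset] m by (intro add_left_mono sum_mono hits_close) auto
    finally show ?thesis .
  qed
  have "avg (Perm E) (\<lambda>\<sigma>. freq Shuffles (\<lambda>\<pi>. (\<Sum>i<s. of_bool (hits \<sigma> (adjust (?T \<pi> i)))) \<noteq> (1::nat)))
     = avg Shuffles (\<lambda>\<pi>. pr (\<lambda>\<sigma>. (\<Sum>i<s. of_bool (hits \<sigma> (adjust (?T \<pi> i)))) \<noteq> (1::nat)))"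
    unfolding freq_def by (rule avg_swap)
  also have "\<dots> \<le> avg Shuffles (\<lambda>\<pi>. excess + (\<Sum>i<s. noise m + of_bool (k < m * gap (?T \<pi> i))))"
    by (rule avg_mono) (rule one)
  also have "\<dots> = excess + (\<Sum>i<s. noise m + avg Shuffles (\<lambda>\<pi>. of_bool (k < m * gap (?T \<pi> i))))"
    by (simp only: avg_add avg_sum avg_const [OF Shuffles_fin_ne])
  also have "\<dots> = excess + (\<Sum>i<s. noise m + deviation m)"
  proof -
    have "avg Shuffles (\<lambda>\<pi>. of_bool (k < m * gap (?T \<pi> i))) = deviation m" if "i < s" for i
    proof -
      have w: "(\<lambda>c\<in>E. i) \<in> Words" using that by (auto simp: Words_def)
      have "act E \<pi> (\<lambda>c\<in>E. i) = act E \<pi> (\<lambda>c. i)" for \<pi> by (rule act_cong) simp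
      with avg_Shuffles_word [OF w, of "\<lambda>y. of_bool (k < m * gap (zeros y))"]
      show ?thesis by (simp add: deviation_def freq_def)
    qed
    then show ?thesis by simp
  qed
  finally show ?thesis by simp
qed

lemma adjust_commutes:
  assumes m: "1 \<le> m"
  shows "avg (Perm E) (\<lambda>\<sigma>. freq (Words \<times> Perm E) (\<lambda>(\<chi>, \<tau>).
      hits \<sigma> (adjust (\<tau> ` zeros \<chi>)) \<noteq> hits \<sigma> (\<tau> ` adjust (zeros \<chi>)))) \<le> noise m + deviation m"
proof -
  have one: "pr (\<lambda>\<sigma>. hits \<sigma> (adjust (\<tau> ` zeros \<chi>)) \<noteq> hits \<sigma> (\<tau> ` adjust (zeros \<chi>)))
      \<le> noise m + of_bool (k < m * gap (zeros \<chi>))" if \<tau>: "\<tau> \<in> Perm E" for \<chi> \<tau>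
  proof (rule hits_close)
    have T: "\<tau> ` zeros \<chi> \<subseteq> E" by (rule Perm_image [OF \<tau> zeros_subset])
    have card: "card (\<tau> ` zeros \<chi>) = card (zeros \<chi>)" by (rule card_Perm_image [OF \<tau>])
    show A: "adjust (\<tau> ` zeros \<chi>) \<in> ksets E k" by (rule adjust(1) [OF T])
    show B: "\<tau> ` adjust (zeros \<chi>) \<in> ksets E k" by (rule ksets_image [OF \<tau> adjust(1) [OF zeros_subset]])
    have "card (adjust (\<tau> ` zeros \<chi>) - \<tau> ` adjust (zeros \<chi>)) \<le> gap (\<tau> ` zeros \<chi>)"
      using adjust(2,3) [OF T] adjust(2,3) [OF zeros_subset, of \<chi>] card
      by (intro card_between_diff [OF T A B]) (auto simp: image_mono)
    then show "card (adjust (\<tau> ` zeros \<chi>) - \<tau> ` adjust (zeros \<chi>)) \<le> gap (zeros \<chi>)"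
      by (simp add: gap_def card)
  qed (rule m)
  have "avg (Perm E) (\<lambda>\<sigma>. freq (Words \<times> Perm E) (\<lambda>(\<chi>, \<tau>).
      hits \<sigma> (adjust (\<tau> ` zeros \<chi>)) \<noteq> hits \<sigma> (\<tau> ` adjust (zeros \<chi>))))
     = avg (Words \<times> Perm E) (\<lambda>(\<chi>, \<tau>). pr (\<lambda>\<sigma>. hits \<sigma> (adjust (\<tau> ` zeros \<chi>)) \<noteq> hits \<sigma> (\<tau> ` adjust (zeros \<chi>))))"
    unfolding freq_def case_prod_unfold by (rule avg_swap)
  also have "\<dots> \<le> avg (Words \<times> Perm E) (\<lambda>(\<chi>, \<tau>). noise m + of_bool (k < m * gap (zeros \<chi>)))"
    by (rule avg_mono) (use one in auto)
  also have "\<dots> = noise m + deviation m"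
    by (simp add: avg_Times avg_add avg_const [OF Words_fin_ne] avg_const [OF Perm_fin_ne] deviation_def freq_def)
  finally show ?thesis .
qed

section \<open>The dictator element and the uniform bound\<close>

lemma card_E_pos: "0 < real (card E)"
  unfolding of_nat_0_less_iff cardE by simp

text \<open>
  Fix a relabelling \<open>\<sigma>\<close> for which both average errors, \<open>colouring_exact\<close> and \<open>adjust_commutes\<close>, are
  small. For this \<open>\<sigma>\<close> the acceptance of the adjusted class of colour \<open>0\<close> depends on the
  colour of one element \<open>c\<close>, hence it is almost constant while \<open>c\<close> is outside that class. A second
  random permutation \<open>\<tau>\<close> turns the adjusted class into a uniformly random \<open>k\<close>-set, and \<open>e = \<sigma> c\<close>.
\<close>

lemma near_dictator:
  assumes m: "1 \<le> m"
    and K: "K = excess + (real s + 1) * (noise m + deviation m)"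
  shows "\<exists>e\<in>E. \<exists>b. freq (ksets E k) (\<lambda>B. e \<notin> B \<and> (B \<in> G) \<noteq> b)
    \<le> real s * (2 * sqrt (24 * K)) + K + 1 / real m + deviation m"
proof -
  define exact where "exact \<sigma> = freq Shuffles (\<lambda>\<pi>.
      (\<Sum>i<s. of_bool (hits \<sigma> (adjust (zeros (act E \<pi> (\<lambda>c. i)))))) \<noteq> (1::nat))" for \<sigma>
  define comm where "comm \<sigma> = freq (Words \<times> Perm E) (\<lambda>(\<chi>, \<tau>).
      hits \<sigma> (adjust (\<tau> ` zeros \<chi>)) \<noteq> hits \<sigma> (\<tau> ` adjust (zeros \<chi>)))" for \<sigma>
  have "avg (Perm E) (\<lambda>\<sigma>. exact \<sigma> + comm \<sigma>) \<le> K"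
    unfolding avg_add K exact_def comm_def
    using colouring_exact [OF m] adjust_commutes [OF m] by (simp add: algebra_simps)
  moreover obtain \<sigma> where \<sigma>: "\<sigma> \<in> Perm E"
    and "exact \<sigma> + comm \<sigma> \<le> avg (Perm E) (\<lambda>\<sigma>. exact \<sigma> + comm \<sigma>)"
    using avg_exists_le [OF Perm_fin_ne, of "\<lambda>\<sigma>. exact \<sigma> + comm \<sigma>"] by blast
  ultimately have sum: "exact \<sigma> + comm \<sigma> \<le> K" by linarith
  have nn: "0 \<le> exact \<sigma>" "0 \<le> comm \<sigma>" unfolding exact_def comm_def by (rule freq_nonneg)+
  interpret exact_colouring E s "\<lambda>\<chi>. hits \<sigma> (adjust (zeros \<chi>))" "exact \<sigma>"
    by unfold_locales (simp add: exact_def)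
  have "E \<noteq> {}" using cardE by auto
  then obtain c \<beta> where c: "c \<in> E"
    and \<beta>: "freq Words (\<lambda>\<chi>. hits \<sigma> (adjust (zeros \<chi>)) \<noteq> \<beta> (\<chi> c)) \<le> 2 * sqrt (24 * exact \<sigma>)"
    using dictator by blast
  define b where "b = \<beta> 1"
  \<comment> \<open>All nonzero colours of \<open>c\<close> give the same class of colour \<open>0\<close>, so the value at colour \<open>1\<close> decides.\<close>
  have bound: "freq Words (\<lambda>\<chi>. c \<notin> zeros \<chi> \<and> hits \<sigma> (adjust (zeros \<chi>)) \<noteq> b) \<le> real s * (2 * sqrt (24 * K))"
  proof -
    have "freq Words (\<lambda>\<chi>. c \<notin> zeros \<chi> \<and> hits \<sigma> (adjust (zeros \<chi>)) \<noteq> b)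
        \<le> real s * freq Words (\<lambda>\<chi>. \<chi> c = 1 \<and> hits \<sigma> (adjust (zeros \<chi>)) \<noteq> b)"
      by (rule freq_nonzero_colour [OF c]) simp
    also have "freq Words (\<lambda>\<chi>. \<chi> c = 1 \<and> hits \<sigma> (adjust (zeros \<chi>)) \<noteq> b)
        \<le> freq Words (\<lambda>\<chi>. hits \<sigma> (adjust (zeros \<chi>)) \<noteq> \<beta> (\<chi> c))"
      by (rule freq_mono) (auto simp: b_def)
    also note \<beta>
    also have "2 * sqrt (24 * exact \<sigma>) \<le> 2 * sqrt (24 * K)" using sum nn by simp
    finally show ?thesis by (simp add: mult_left_mono)
  qed
  let ?Q = "Words \<times> Perm E"
  have moved: "freq ?Q (\<lambda>(\<chi>, \<tau>). c \<notin> \<tau> ` zeros \<chi> \<and> hits \<sigma> (adjust (\<tau> ` zeros \<chi>)) \<noteq> b)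
      \<le> real s * (2 * sqrt (24 * K))"
  proof -
    have "freq ?Q (\<lambda>(\<chi>, \<tau>). c \<notin> \<tau> ` zeros \<chi> \<and> hits \<sigma> (adjust (\<tau> ` zeros \<chi>)) \<noteq> b)
      = avg (Perm E) (\<lambda>\<tau>. avg Words (\<lambda>\<chi>. of_bool (c \<notin> \<tau> ` zeros \<chi> \<and> hits \<sigma> (adjust (\<tau> ` zeros \<chi>)) \<noteq> b)))"
      unfolding freq_def avg_Times prod.case by (rule avg_swap)
    also have "\<dots> = avg (Perm E) (\<lambda>\<tau>. freq Words (\<lambda>\<chi>. c \<notin> zeros \<chi> \<and> hits \<sigma> (adjust (zeros \<chi>)) \<noteq> b))"
      unfolding freq_def
      by (rule avg_cong) (rule avg_zeros_image [of _ "\<lambda>T. of_bool (c \<notin> T \<and> hits \<sigma> (adjust T) \<noteq> b)"])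
    also have "\<dots> \<le> real s * (2 * sqrt (24 * K))"
      using bound by (simp add: avg_const [OF Perm_fin_ne])
    finally show ?thesis .
  qed
  \<comment> \<open>When \<open>adjust\<close> removes elements from the class, \<open>c\<close> is rarely among them.\<close>
  have lost: "freq ?Q (\<lambda>(\<chi>, \<tau>). c \<in> \<tau> ` (zeros \<chi> - adjust (zeros \<chi>))) \<le> 1 / real m + deviation m"
  proof -
    have "freq (Perm E) (\<lambda>\<tau>. c \<in> \<tau> ` (zeros \<chi> - adjust (zeros \<chi>))) \<le> 1 / real m + of_bool (k < m * gap (zeros \<chi>))"
      for \<chi>
    proof (cases "k < m * gap (zeros \<chi>)")
      case True
      have "freq (Perm E) (\<lambda>\<tau>. c \<in> \<tau> ` (zeros \<chi> - adjust (zeros \<chi>))) \<le> 1" by (rule freq_le_1)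
      moreover have "0 \<le> 1 / real m" "of_bool (k < m * gap (zeros \<chi>)) = (1::real)" using True by simp_all
      ultimately show ?thesis by linarith
    next
      case False
      let ?T = "zeros \<chi>"
      have T: "?T \<subseteq> E" "finite ?T" using zeros_subset finE finite_subset by blast+
      have "card (?T - adjust ?T) \<le> gap ?T"
      proof (cases "k \<le> card ?T")
        case True
        then have "card (?T - adjust ?T) = card ?T - k"
          using adjust(1,2) [OF T(1)] T(2) by (simp add: ksets_def card_Diff_subset finite_subset)
        then show ?thesis by (simp add: gap_def)
      next
        case False
        then have "?T - adjust ?T = {}" using adjust(3) [OF T(1)] by auto
        then show ?thesis by (simp only: card.empty le0)
      qed
      then have "m * card (?T - adjust ?T) \<le> m * gap ?T" by simp
      then have "m * card (?T - adjust ?T) \<le> card E" using False k_le_card by linarith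
      then have "real (m * card (?T - adjust ?T)) \<le> real (card E)" by (simp only: of_nat_le_iff)
      moreover note card_E_pos
      ultimately have "real (card (?T - adjust ?T)) / real (card E) \<le> 1 / real m"
        using m by (simp add: field_simps)
      moreover have "freq (Perm E) (\<lambda>\<tau>. c \<in> \<tau> ` (?T - adjust ?T)) \<le> real (card (?T - adjust ?T)) / real (card E)"
        by (rule freq_Perm_mem [OF finE c]) (use T in auto)
      ultimately show ?thesis by simp
    qed
    then have "freq ?Q (\<lambda>(\<chi>, \<tau>). c \<in> \<tau> ` (zeros \<chi> - adjust (zeros \<chi>)))
        \<le> avg Words (\<lambda>\<chi>. 1 / real m + of_bool (k < m * gap (zeros \<chi>)))"
      unfolding freq_def avg_Times prod.case by (intro avg_mono)
    also have "\<dots> = 1 / real m + deviation m"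
      by (simp add: avg_add avg_const [OF Words_fin_ne] deviation_def freq_def)
    finally show ?thesis .
  qed
  have "freq ?Q (\<lambda>(\<chi>, \<tau>). c \<notin> \<tau> ` adjust (zeros \<chi>) \<and> hits \<sigma> (\<tau> ` adjust (zeros \<chi>)) \<noteq> b)
     \<le> freq ?Q (\<lambda>(\<chi>, \<tau>). c \<notin> \<tau> ` zeros \<chi> \<and> hits \<sigma> (adjust (\<tau> ` zeros \<chi>)) \<noteq> b)
       + freq ?Q (\<lambda>(\<chi>, \<tau>). hits \<sigma> (adjust (\<tau> ` zeros \<chi>)) \<noteq> hits \<sigma> (\<tau> ` adjust (zeros \<chi>)))
       + freq ?Q (\<lambda>(\<chi>, \<tau>). c \<in> \<tau> ` (zeros \<chi> - adjust (zeros \<chi>)))"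
    by (rule freq_le3) auto
  also have "\<dots> \<le> real s * (2 * sqrt (24 * K)) + comm \<sigma> + (1 / real m + deviation m)"
    using moved lost unfolding comm_def by linarith
  also have "\<dots> \<le> real s * (2 * sqrt (24 * K)) + K + 1 / real m + deviation m"
    using sum nn by linarith
  finally have total: "freq ?Q (\<lambda>(\<chi>, \<tau>). c \<notin> \<tau> ` adjust (zeros \<chi>) \<and> hits \<sigma> (\<tau> ` adjust (zeros \<chi>)) \<noteq> b)
     \<le> real s * (2 * sqrt (24 * K)) + K + 1 / real m + deviation m" .
  have "freq ?Q (\<lambda>(\<chi>, \<tau>). c \<notin> \<tau> ` adjust (zeros \<chi>) \<and> hits \<sigma> (\<tau> ` adjust (zeros \<chi>)) \<noteq> b)
     = avg Words (\<lambda>\<chi>. freq (ksets E k) (\<lambda>B. c \<notin> B \<and> hits \<sigma> B \<noteq> b))"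
    unfolding freq_def avg_Times prod.case
    by (rule avg_cong)
       (rule avg_perm_image [OF finE adjust(1) [OF zeros_subset], of "\<lambda>B. of_bool (c \<notin> B \<and> hits \<sigma> B \<noteq> b)"])
  also have "\<dots> = freq (ksets E k) (\<lambda>B. c \<notin> B \<and> hits \<sigma> B \<noteq> b)"
    by (rule avg_const [OF Words_fin_ne])
  also have "\<dots> = freq (ksets E k) (\<lambda>B. \<sigma> c \<notin> B \<and> (B \<in> G) \<noteq> b)"
    unfolding freq_def hits_def
    using avg_reindex [OF bij_betw_ksets_image [OF \<sigma>], of k "\<lambda>B. of_bool (\<sigma> c \<notin> B \<and> (B \<in> G) \<noteq> b)"]
    by (simp add: inj_image_mem_iff [OF Perm_inj [OF \<sigma>]])
  finally have "freq (ksets E k) (\<lambda>B. \<sigma> c \<notin> B \<and> (B \<in> G) \<noteq> b)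
     \<le> real s * (2 * sqrt (24 * K)) + K + 1 / real m + deviation m" using total by simp
  moreover have "\<sigma> c \<in> E" using Perm_image [OF \<sigma>, of "{c}"] c by simp
  ultimately show ?thesis by blast
qed

lemma freq_avoiding:
  assumes e: "e \<in> E"
  shows "1 - 1 / real s \<le> freq (ksets E k) (\<lambda>B. e \<notin> B)"
proof -
  obtain A where A: "A \<in> ksets E k" using ksets_nonempty [OF k_le_card] by blast
  then have AE: "A \<subseteq> E" "card A = k" by (auto simp: ksets_def)
  have fin: "finite (ksets E k)" "ksets E k \<noteq> {}" using finite_ksets [OF finE] A by auto
  have "freq (ksets E k) (\<lambda>B. e \<in> B) = freq (Perm E) (\<lambda>\<tau>. e \<in> \<tau> ` A)"
    unfolding freq_def by (rule avg_perm_image [OF finE A, symmetric])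
  also have "\<dots> \<le> real (card A) / real (card E)" by (rule freq_Perm_mem [OF finE e AE(1)])
  also have "\<dots> \<le> 1 / real s"
  proof -
    have "real s * real k \<le> real (card E)" using cardE by simp
    then show ?thesis using AE(2) s3 card_E_pos by (simp add: pos_divide_le_eq mult.commute pos_le_divide_eq)
  qed
  finally have "freq (ksets E k) (\<lambda>B. e \<in> B) \<le> 1 / real s" .
  moreover have "1 \<le> freq (ksets E k) (\<lambda>B. e \<in> B) + freq (ksets E k) (\<lambda>B. e \<notin> B)"
    using freq_le2 [of "ksets E k" "\<lambda>_. True" "\<lambda>B. e \<in> B" "\<lambda>B. e \<notin> B"] freq_True [OF fin, of "\<lambda>_. True"] by simp
  ultimately show ?thesis by linarith
qed

text \<open>
  Without \<open>e\<close> there are exactly \<open>s * k\<close> elements, and \<open>G\<close> meets all their partitions into \<open>k\<close>-sets, so it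
  contains at least the fraction \<open>1 / s\<close> of the \<open>k\<close>-sets that avoid \<open>e\<close>.
\<close>

lemma freq_avoiding_in_family:
  assumes e: "e \<in> E"
  shows "(1 - 1 / real s) / real s \<le> freq (ksets E k) (\<lambda>B. e \<notin> B \<and> B \<in> G)"
proof -
  let ?E = "E - {e}"
  have finE': "finite ?E" using finE by simp
  have cardE': "card ?E = s * k" using cardE e finE by simp
  obtain P where P: "\<And>i. i < s \<Longrightarrow> P i \<in> ksets ?E k" "disjoint_family_on P {..<s}"
    using obtain_disjoint_ksets [OF finE', of s k] cardE' by auto
  have sub: "B \<in> ksets E k" if "B \<in> ksets ?E k" for B using that by (auto simp: ksets_def)
  have "0 \<le> freq (Perm ?E) (\<lambda>\<sigma>. (\<Sum>i<s. of_bool (\<sigma> ` P i \<in> G)) \<noteq> (1::nat))" by (rule freq_nonneg)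
  also have "\<dots> \<le> real s * freq (ksets ?E k) (\<lambda>A. A \<in> G) - 1"
  proof (rule hitting_density [OF finE' P(1)])
    fix \<sigma> assume \<sigma>: "\<sigma> \<in> Perm ?E"
    then have \<sigma>E: "\<sigma> \<in> Perm E" by (auto simp: Perm_def intro: permutes_subset)
    show "\<exists>i<s. \<sigma> ` P i \<in> G"
      by (rule hit) (use sub ksets_image [OF \<sigma> P(1)] disjoint_family_perm [OF \<sigma>E P(2)] in auto)
  qed
  finally have "1 \<le> real s * freq (ksets ?E k) (\<lambda>A. A \<in> G)" by simp
  then have dens: "1 / real s \<le> freq (ksets ?E k) (\<lambda>A. A \<in> G)" using s3 by (simp add: field_simps)
  have eq: "{B \<in> ksets E k. e \<notin> B} = ksets ?E k" "{B \<in> ksets E k. e \<notin> B \<and> B \<in> G} = {B \<in> ksets ?E k. B \<in> G}"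
    by (auto simp: ksets_def)
  have "0 < card (ksets ?E k)"
    using card_ksets [OF finE', of k] cardE' s3 by (simp add: zero_less_binomial_iff)
  then have "freq (ksets E k) (\<lambda>B. e \<notin> B \<and> B \<in> G) = freq (ksets E k) (\<lambda>B. e \<notin> B) * freq (ksets ?E k) (\<lambda>A. A \<in> G)"
    unfolding freq_card eq by simp
  moreover have "(1 - 1 / real s) * (1 / real s)
      \<le> freq (ksets E k) (\<lambda>B. e \<notin> B) * freq (ksets ?E k) (\<lambda>A. A \<in> G)"
    by (rule mult_mono [OF freq_avoiding [OF e] dens freq_nonneg]) simp
  ultimately show ?thesis by simp
qed

text \<open>
  If \<open>G\<close> contained almost all sets avoiding \<open>e\<close>, its density \<open>(1 + excess) / s\<close> would be almost
  \<open>1 - 1 / s\<close>; almost none contradicts \<open>freq_avoiding_in_family\<close>. For \<open>s \<ge> 3\<close> both alternatives are off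
  by at least \<open>1 / (2 * s)\<close>.
\<close>

lemma error_lower_bound:
  assumes m: "1 \<le> m" and ex: "excess \<le> 1 / 2"
    and K: "K = excess + (real s + 1) * (noise m + deviation m)"
  shows "1 / (2 * real s) \<le> real s * (2 * sqrt (24 * K)) + K + 1 / real m + deviation m" (is "_ \<le> ?R")
proof -
  obtain e b where e: "e \<in> E" and b: "freq (ksets E k) (\<lambda>B. e \<notin> B \<and> (B \<in> G) \<noteq> b) \<le> ?R"
    using near_dictator [OF m K] by blast
  have s: "3 \<le> real s" using s3 by simp
  show ?thesis
  proof (cases b)
    case True
    have "freq (ksets E k) (\<lambda>B. e \<notin> B)
        \<le> freq (ksets E k) (\<lambda>B. e \<notin> B \<and> (B \<in> G) \<noteq> b) + freq (ksets E k) (\<lambda>B. B \<in> G)"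
      by (rule freq_le2) (use True in auto)
    moreover have "freq (ksets E k) (\<lambda>B. B \<in> G) = (1 + excess) / real s"
      using s by (simp add: excess_def)
    moreover have "1 / (2 * real s) + (1 + excess) / real s \<le> 1 - 1 / real s"
    proof -
      have "1 / (2 * real s) + (1 + excess) / real s + 1 / real s = (5 / 2 + excess) / real s"
        using s by (simp add: field_simps)
      also have "\<dots> \<le> 3 / real s" using s ex by (intro divide_right_mono) auto
      also have "\<dots> \<le> 1" using s by simp
      finally show ?thesis by linarith
    qed
    ultimately show ?thesis using freq_avoiding [OF e] b by linarith
  next
    case False
    then have "freq (ksets E k) (\<lambda>B. e \<notin> B \<and> B \<in> G) \<le> ?R" using b by simp
    moreover have "1 / (2 * real s) \<le> (1 - 1 / real s) / real s"
      using s by (simp add: field_simps)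
    ultimately show ?thesis using freq_avoiding_in_family [OF e] by linarith
  qed
qed

text \<open>
  The parameter \<open>m\<close> only has to make \<open>s * sqrt (s / m)\<close> small compared with \<open>1 / s\<close>. For \<open>k < 2 * m ^ 3\<close>
  the bound is \<open>excess_lower_bound\<close>; for larger \<open>k\<close> the deviation is at most \<open>1 / m\<close>, and an \<open>excess\<close>
  below \<open>1 / m ^ 2\<close> would contradict \<open>error_lower_bound\<close>.
\<close>

lemma excess_uniform_bound:
  assumes m: "m = 10000 * s ^ 5"
  shows "1 / (1 + 4 * real s * real m ^ 3) \<le> excess"
proof (rule ccontr)
  assume "\<not> ?thesis"
  then have small: "excess < 1 / (1 + 4 * real s * real m ^ 3)" by simp
  have s: "3 \<le> real s" using s3 by simp
  have m1: "1 \<le> m" using m s3 by simp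
  have M: "1 \<le> real m" using m1 by simp
  have Meq: "real m = 10000 * real s ^ 5" using m by simp
  have pos: "0 < 1 + 4 * real s * real m ^ 3" using s M by (simp add: add_pos_nonneg)
  have large: "2 * m ^ 3 \<le> k"
  proof (rule ccontr)
    assume "\<not> ?thesis"
    then have "real k \<le> real (2 * m ^ 3)" by (simp only: of_nat_le_iff)
    then have "1 + 2 * real s * real k \<le> 1 + 4 * real s * real m ^ 3" using s by simp
    then have "(1 + 2 * real s * real k) * excess \<le> (1 + 4 * real s * real m ^ 3) * excess"
      using excess_nonneg by (rule mult_right_mono)
    with excess_lower_bound have "1 \<le> (1 + 4 * real s * real m ^ 3) * excess" by linarith
    with small pos show False by (simp add: field_simps)
  qed
  have mm: "excess \<le> 1 / (real m)\<^sup>2"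
  proof -
    have "(real m)\<^sup>2 \<le> (real m) ^ 3" using M by (rule power_increasing [rotated]) simp
    moreover have "real m ^ 3 \<le> 4 * real s * real m ^ 3" using s M by simp
    ultimately have "(real m)\<^sup>2 \<le> 1 + 4 * real s * real m ^ 3" by linarith
    then have "1 / (1 + 4 * real s * real m ^ 3) \<le> 1 / (real m)\<^sup>2"
      using M by (intro divide_left_mono mult_pos_pos pos) auto
    with small show ?thesis by linarith
  qed
  have dev: "deviation m \<le> 1 / real m"
  proof -
    have "real (2 * m ^ 3) \<le> real k" using large by (simp only: of_nat_le_iff)
    then have k: "2 * real m ^ 3 \<le> real k" by simp
    have "0 < real k" using k1 by simp
    then have "2 * (real m)\<^sup>2 / real k \<le> 2 * (real m)\<^sup>2 / (2 * real m ^ 3)"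
      using k M by (intro divide_left_mono mult_pos_pos) auto
    also have "\<dots> = 1 / real m" using M by (simp add: power2_eq_square power3_eq_cube)
    finally show ?thesis using deviation_le [OF m1] by linarith
  qed
  have noise: "noise m \<le> 3 / real m"
  proof -
    have "2 * real m * excess \<le> 2 * real m * (1 / (real m)\<^sup>2)" using mm M by (intro mult_left_mono) auto
    also have "\<dots> = 2 / real m" using M by (simp add: power2_eq_square)
    finally show ?thesis by (simp add: noise_def)
  qed
  have exm: "excess \<le> 1 / real m"
  proof -
    have "1 / (real m)\<^sup>2 \<le> 1 / real m" using M by (intro divide_left_mono) (auto simp: power2_eq_square)
    with mm show ?thesis by linarith
  qed
  define K where "K = excess + (real s + 1) * (noise m + deviation m)"
  have K: "K \<le> 6 * real s / real m"
  proof -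
    have "(real s + 1) * (noise m + deviation m) \<le> (real s + 1) * (4 / real m)"
      using noise dev s by (intro mult_left_mono) auto
    then have "K \<le> 1 / real m + (real s + 1) * (4 / real m)" using exm by (simp add: K_def)
    also have "\<dots> = (4 * real s + 5) / real m" using M by (simp add: field_simps)
    also have "\<dots> \<le> 6 * real s / real m" using s M by (intro divide_right_mono) auto
    finally show ?thesis .
  qed
  have sm: "real s / real m = 1 / (100 * (real s)\<^sup>2)\<^sup>2"
    unfolding Meq using s by (simp add: field_simps power2_eq_square) (simp add: eval_nat_numeral)
  have "sqrt (24 * K) \<le> sqrt (12\<^sup>2 * (real s / real m))" using K by (intro real_sqrt_le_mono) simp
  also have "\<dots> = 12 / (100 * (real s)\<^sup>2)"
    unfolding sm by (simp only: real_sqrt_mult real_sqrt_divide real_sqrt_one real_sqrt_abs) (use s in simp)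
  finally have "real s * (2 * sqrt (24 * K)) \<le> real s * (2 * (12 / (100 * (real s)\<^sup>2)))"
    using s by (intro mult_left_mono) auto
  also have "\<dots> = 24 / (100 * real s)" using s by (simp add: power2_eq_square)
  finally have A: "real s * (2 * sqrt (24 * K)) \<le> (24 / 100) / real s" by simp
  have B: "K + 1 / real m + deviation m \<le> (8 / 10000) / real s"
  proof -
    have "K + 1 / real m + deviation m \<le> 6 * real s / real m + 1 / real m + 1 / real m" using K dev by linarith
    also have "\<dots> \<le> 8 * real s / real m" using s M by (simp add: field_simps)
    also have "8 * real s / real m = (8 / 10000) / real s ^ 4"
      unfolding Meq using s by (simp add: field_simps eval_nat_numeral)
    also have "\<dots> \<le> (8 / 10000) / real s"
      using s power_increasing [of 1 4 "real s"] by (intro divide_left_mono) auto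
    finally show ?thesis .
  qed
  have "1 / (2 * real s) \<le> real s * (2 * sqrt (24 * K)) + K + 1 / real m + deviation m"
  proof (rule error_lower_bound [OF m1 _ K_def])
    have "real m \<ge> 10000" unfolding Meq using s by (simp add: one_le_power)
    then have "1 / real m \<le> 1 / 2" by (intro divide_left_mono) auto
    with exm show "excess \<le> 1 / 2" by linarith
  qed
  with A B have "1 / (2 * real s) \<le> (24 / 100) / real s + (8 / 10000) / real s" by linarith
  with s show False by (simp add: field_simps)
qed

end

lemma matching_number_ge:
  assumes "finite F" "M \<subseteq> F" "pairwise disjnt M"
  shows "card M \<le> matching_number F"
  unfolding matching_number_def
  using matching_number_well_defined(1) [OF assms(1)] assms(2,3) by (intro Max_ge) auto

lemma complement_hits:
  assumes k: "1 \<le> k" and F: "F \<subseteq> k_subsets n k" "matching_number F < s"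
    and P: "\<And>i. i < s \<Longrightarrow> P i \<in> ksets {1..n} k" "disjoint_family_on P {..<s}"
  shows "\<exists>i<s. P i \<notin> F"
proof (rule ccontr)
  assume "\<not> ?thesis"
  then have "P ` {..<s} \<subseteq> F" by auto
  moreover have "pairwise disjnt (P ` {..<s})"
  proof (rule pairwiseI)
    fix A B assume "A \<in> P ` {..<s}" "B \<in> P ` {..<s}" "A \<noteq> B"
    then obtain i j where "i \<in> {..<s}" "j \<in> {..<s}" "i \<noteq> j" "A = P i" "B = P j" by auto
    then show "disjnt A B" using P(2) unfolding disjoint_family_on_def disjnt_def by blast
  qed
  moreover have "finite F" using F(1) finite_k_subsets finite_subset by blast
  ultimately have "card (P ` {..<s}) \<le> matching_number F" using matching_number_ge by blast
  moreover have "inj_on P {..<s}"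
  proof (rule inj_onI, rule ccontr)
    fix i j assume ij: "i \<in> {..<s}" "j \<in> {..<s}" "P i = P j" "i \<noteq> j"
    then have "P i \<inter> P j = {}" using P(2) unfolding disjoint_family_on_def by blast
    then have "P i = {}" using ij by simp
    then show False using P(1) [of i] ij k by (auto simp: ksets_def)
  qed
  ultimately show False using F(2) by (simp add: card_image)
qed

theorem theorem3:
  fixes s :: nat
  assumes "s \<ge> 3"
  shows "\<exists>\<epsilon>::real. \<epsilon> > 0 \<and>
    (\<forall>k::nat. k \<ge> 1 \<longrightarrow>
      real (max_family_size (s * k + 1) k s)
        \<le> ((real s - 1) / real s - \<epsilon>) * real ((s * k + 1) choose k))"
proof -
  define m where "m = 10000 * s ^ 5"
  define \<epsilon> where "\<epsilon> = 1 / (1 + 4 * real s * real m ^ 3) / real s"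
  have "0 < 1 + 4 * real s * real m ^ 3" by (simp add: add_pos_nonneg)
  then have "0 < \<epsilon>" using assms by (simp add: \<epsilon>_def)
  moreover have "real (max_family_size (s * k + 1) k s)
      \<le> ((real s - 1) / real s - \<epsilon>) * real ((s * k + 1) choose k)" if k: "k \<ge> 1" for k
  proof -
    let ?n = "s * k + 1"
    let ?S = "{card F | F. F \<subseteq> k_subsets ?n k \<and> matching_number F < s}"
    have "max_family_size ?n k s \<in> ?S"
      unfolding max_family_size_def
      by (rule Max_in [OF max_family_size_well_defined(1)], rule max_family_size_well_defined(2))
        (use assms in simp)
    then obtain F where F: "F \<subseteq> k_subsets ?n k" "matching_number F < s"
      and size: "max_family_size ?n k s = card F" by auto
    have ks: "k_subsets ?n k = ksets {1..?n} k" by (simp add: k_subsets_def ksets_def)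
    \<comment> \<open>Sets of other sizes in \<open>- F\<close> are harmless, as the locale tests members of \<open>ksets\<close> only.\<close>
    interpret hitting_family "{1..?n}" s k "- F"
    proof
      fix P assume "\<And>i. i < s \<Longrightarrow> P i \<in> ksets {1..?n} k" "disjoint_family_on P {..<s}"
      from complement_hits [OF k F this] show "\<exists>i<s. P i \<in> - F" by simp
    qed (use assms k in auto)
    have N: "card (ksets {1..?n} k) = ?n choose k" by (simp add: card_ksets)
    have pos: "0 < real (?n choose k)" using k_le_card by (simp add: zero_less_binomial_iff)
    have "{A \<in> ksets {1..?n} k. A \<in> - F} = ksets {1..?n} k - F" by auto
    moreover have "card (ksets {1..?n} k - F) = card (ksets {1..?n} k) - card F"
      by (rule card_Diff_subset) (use F(1) ks finite_subset [OF F(1) finite_k_subsets] in auto)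
    moreover have "card F \<le> card (ksets {1..?n} k)"
      using F(1) ks finite_k_subsets [of ?n k] by (simp add: card_mono)
    ultimately have "excess = real s * ((real (?n choose k) - real (card F)) / real (?n choose k)) - 1"
      unfolding excess_def freq_card N by (simp add: N of_nat_diff)
    with excess_uniform_bound [OF m_def]
    have "\<epsilon> * real s \<le> real s * ((real (?n choose k) - real (card F)) / real (?n choose k)) - 1"
      using assms by (simp add: \<epsilon>_def)
    then have "real s * real (card F) \<le> (real s - 1 - \<epsilon> * real s) * real (?n choose k)"
      using pos by (simp add: field_simps)
    then have "real (card F) \<le> (real s - 1 - \<epsilon> * real s) * real (?n choose k) / real s"
      using assms by (simp add: field_simps)
    also have "\<dots> = ((real s - 1) / real s - \<epsilon>) * real (?n choose k)"
      using assms by (simp add: field_simps)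
    finally show ?thesis by (simp only: size)
  qed
  ultimately show ?thesis by blast
qed

end
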